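(* Let $n\ge1$ and $m,k\ge0$ be integers. The Newton-Okounkov body of $\mathcal{O}(m,k)$ on $\mathrm{Hilb}^{n,n+1}(\mathbb{C}^2)$ with respect to the trailing-term valuation $\nu$ is $$\mathbb{R}_{\ge0}^2\times\Delta(m+k,k)\subseteq\mathbb{R}^{2n+2},$$ where $\Delta(m+k,k)\subseteq\mathbb{R}^{2n}$ is the polyhedron of points $(a_1,\dots,a_n,b_1,\dots,b_n)$ such that $0\le a_1\le a_2\le\cdots\le a_n$ and, for each $j=1,\dots,n$, $$b_j\ge\max\{k-a_j,0\}+\sum_{i=1}^{j-1}\max\{m+k-(a_j-a_i),0\}.$$
   Context: The nested Hilbert scheme $\mathrm{Hilb}^{n,n+1}(\mathbb{C}^2)$ parametrizes pairs of subschemes $Z\subset Z'$ of $\mathbb{C}^2$ of lengths $n$ and $n+1$, with projections $\pi_n,\pi_{n+1}$ to $\mathrm{Hilb}^n(\mathbb{C}^2)$ and $\mathrm{Hilb}^{n+1}(\mathbb{C}^2)$. On a Hilbert scheme of points $\mathcal{O}(1)$ is the determinant of the tautological bundle (fiber $\mathbb{C}[x,y]/\mathcal{I}$ at $\mathcal{I}$), $\mathcal{O}(d)=\mathcal{O}(1)^{\otimes d}$, and $\mathcal{O}(m,k)=\pi_n^*\mathcal{O}(m)\otimes\pi_{n+1}^*\mathcal{O}(k)$, so $\mathcal{O}(m,k)^{\otimes d}=\mathcal{O}(dm,dk)$. For $m,k\ge0$, $H^0(\mathrm{Hilb}^{n,n+1}(\mathbb{C}^2),\mathcal{O}(m,k))$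 is identified (compatibly with products) with the $\mathrm{sgn}(m+k)$-component of $J^{m+k}\cap I^k\subseteq\mathbb{C}[x_1,y_1,\dots,x_n,y_n,x,y]$, where $J=\bigcap_{i<j}(x_i-x_j,y_i-y_j)$ (for $n=1$ the whole ring) and $I=\bigcap_{i=1}^n(x_i-x,y_i-y)$; $S_n$ permutes the pairs $(x_i,y_i)$ simultaneously and fixes $x,y$, and $\mathrm{sgn}(d)$ is the trivial character for $d$ even and the sign character for $d$ odd. The valuation $\nu$ sends a nonzero polynomial $f$ in the space identified with $H^0(\mathrm{Hilb}^{n,n+1}(\mathbb{C}^2),\mathcal{O}(dm,dk))$ to its trailing term exponent: the exponent vector $(a,b,a_1,\dots,a_n,b_1,\dots,b_n)\in\mathbb{Z}^{2n+2}$ (exponents of $x,y,x_1,\dots,x_n,y_1,\dots,y_n$) which is lexicographically minimal among all terms of $f$. The Newton-Okounkov body of a line bundle $\mathcal{L}$ on $X$ with respect to $\nu$ is the closed convex hull in $\mathbb{R}^{\dim X}$ of $$\bigcup_{d\ge1}\frac1d\cdot\mathrm{Im}\left(\nu:H^0(X,\mathcal{L}^{\otimes d})\setminus\{0\}\to\mathbb{Z}^{\dim X}\right).$$ *)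

theory Defs
  imports
    "HOL-Analysis.Analysis"
    "HOL-Library.Poly_Mapping"
    "HOL-Combinatorics.Permutations"
begin

text \<open>
  The index set \<open>{1, ..., n}\<close> is rendered as an arbitrary finite linearly ordered
  type \<open>'n\<close>, so that \<open>n = CARD('n) \<ge> 1\<close> is arbitrary and the \<open>j\<close>-th element of \<open>'n\<close>
  plays the role of \<open>j\<close>.
\<close>

datatype 'n var = Vx | Vy | Vxi 'n | Vyi 'n

instance var :: (finite) finite
proof
  have "(UNIV :: 'a var set) = {Vx, Vy} \<union> range Vxi \<union> range Vyi"
  proof (intro set_eqI iffI UNIV_I)
    fix v :: "'a var"
    show "v \<in> {Vx, Vy} \<union> range Vxi \<union> range Vyi"
      by (cases v) auto
  qed
  then show "finite (UNIV :: 'a var set)"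
    by (metis finite.emptyI finite.insertI finite_UnI finite_class.finite_UNIV finite_imageI)
qed

text \<open>The variables are ordered as \<open>x < y < x\<^sub>1 < ... < x\<^sub>n < y\<^sub>1 < ... < y\<^sub>n\<close>.\<close>

instantiation var :: (linorder) linorder
begin

fun less_eq_var :: "'a var \<Rightarrow> 'a var \<Rightarrow> bool" where
  "Vx \<le> w \<longleftrightarrow> True"
| "Vy \<le> w \<longleftrightarrow> w \<noteq> Vx"
| "Vxi i \<le> w \<longleftrightarrow> (case w of Vxi j \<Rightarrow> i \<le> j | Vyi j \<Rightarrow> True | _ \<Rightarrow> False)"
| "Vyi i \<le> w \<longleftrightarrow> (case w of Vyi j \<Rightarrow> i \<le> j | _ \<Rightarrow> False)"

definition less_var :: "'a var \<Rightarrow> 'a var \<Rightarrow> bool" where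
  "v < w \<longleftrightarrow> \<not> w \<le> v" for v w :: "'a var"

instance
proof
  fix u v w :: "'a var"
  show "u \<le> u" by (cases u) auto
  show "u \<le> v \<or> v \<le> u" by (cases u; cases v) auto
  then show "u < v \<longleftrightarrow> u \<le> v \<and> \<not> v \<le> u" by (auto simp: less_var_def)
  show "u \<le> w" if "u \<le> v" "v \<le> w"
    using that by (cases u; cases v; cases w) auto
  show "u = v" if "u \<le> v" "v \<le> u"
    using that by (cases u; cases v) auto
qed

end

text \<open>
  The polynomial ring \<open>\<complex>[x\<^sub>1, y\<^sub>1, ..., x\<^sub>n, y\<^sub>n, x, y]\<close>, as finitely supported
  functions from exponent vectors to coefficients.
\<close>

type_synonym 'n cpoly = "('n var \<Rightarrow>\<^sub>0 nat) \<Rightarrow>\<^sub>0 complex"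

definition Var :: "'n var \<Rightarrow> 'n cpoly" where
  "Var v = Poly_Mapping.single (Poly_Mapping.single v 1) 1"

lemma module_times: "module ((*) :: 'a::comm_ring_1 \<Rightarrow> 'a \<Rightarrow> 'a)"
  by unfold_locales (auto simp: algebra_simps)

text \<open>The ideal generated by a set: the ring is viewed as a module over itself.\<close>

definition ideal_gen :: "'a::comm_ring_1 set \<Rightarrow> 'a set" where
  "ideal_gen S = module.span (*) S"

primrec ideal_pow :: "'a::comm_ring_1 set \<Rightarrow> nat \<Rightarrow> 'a set" where
  "ideal_pow A 0 = UNIV"
| "ideal_pow A (Suc d) = ideal_gen {a * b | a b. a \<in> A \<and> b \<in> ideal_pow A d}"

text \<open>For \<open>n = 1\<close> the intersection is over the empty family, hence the whole ring.\<close>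

definition ideal_J :: "'n::linorder cpoly set" where
  "ideal_J = (\<Inter>(i, j) \<in> {(i, j). i < j}.
      ideal_gen {Var (Vxi i) - Var (Vxi j), Var (Vyi i) - Var (Vyi j)})"

definition ideal_I :: "'n cpoly set" where
  "ideal_I = (\<Inter>i. ideal_gen {Var (Vxi i) - Var Vx, Var (Vyi i) - Var Vy})"

fun perm_var :: "('n \<Rightarrow> 'n) \<Rightarrow> 'n var \<Rightarrow> 'n var" where
  "perm_var \<sigma> Vx = Vx"
| "perm_var \<sigma> Vy = Vy"
| "perm_var \<sigma> (Vxi i) = Vxi (\<sigma> i)"
| "perm_var \<sigma> (Vyi i) = Vyi (\<sigma> i)"

text \<open>
  The ring automorphism replacing each variable \<open>v\<close> by \<open>perm_var \<sigma> v\<close>: the coefficient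
  of the monomial with exponents \<open>t\<close> in the image of \<open>f\<close> is the coefficient in \<open>f\<close> of
  the monomial with exponents \<open>t \<circ> perm_var \<sigma>\<close>. (Library function \<open>map_key\<close> is
  precomposition for injective maps; both maps are bijective if \<open>\<sigma>\<close> is.)
\<close>

definition perm_poly :: "('n \<Rightarrow> 'n) \<Rightarrow> 'n cpoly \<Rightarrow> 'n cpoly" where
  "perm_poly \<sigma> f = Poly_Mapping.map_key (Poly_Mapping.map_key (perm_var \<sigma>)) f"

lemma bij_perm_var:
  assumes "bij \<sigma>"
  shows "bij (perm_var \<sigma>)"
proof (rule o_bij)
  show "perm_var (inv \<sigma>) \<circ> perm_var \<sigma> = id"
  proof
    fix v show "(perm_var (inv \<sigma>) \<circ> perm_var \<sigma>) v = id v"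
      using assms by (cases v) (auto simp: bij_is_inj)
  qed
  show "perm_var \<sigma> \<circ> perm_var (inv \<sigma>) = id"
  proof
    fix v show "(perm_var \<sigma> \<circ> perm_var (inv \<sigma>)) v = id v"
      using assms by (cases v) (auto simp: bij_is_surj surj_f_inv_f)
  qed
qed

lemma inj_map_key_perm_var:
  assumes "bij \<sigma>"
  shows "inj (Poly_Mapping.map_key (perm_var \<sigma>) :: ('n var \<Rightarrow>\<^sub>0 nat) \<Rightarrow> _)"
proof (rule injI)
  fix s t :: "'n var \<Rightarrow>\<^sub>0 nat"
  note b = bij_perm_var[OF assms]
  assume eq: "Poly_Mapping.map_key (perm_var \<sigma>) s = Poly_Mapping.map_key (perm_var \<sigma>) t"
  show "s = t"
  proof (rule poly_mapping_eqI)
    fix v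
    obtain w where v: "v = perm_var \<sigma> w" using b by (metis bij_pointE)
    show "Poly_Mapping.lookup s v = Poly_Mapping.lookup t v"
      using arg_cong[OF eq, of "\<lambda>p. Poly_Mapping.lookup p w"] b
      by (simp add: v map_key.rep_eq bij_is_inj)
  qed
qed

lemma lookup_perm_poly:
  assumes "bij \<sigma>"
  shows "Poly_Mapping.lookup (perm_poly \<sigma> f) t =
    Poly_Mapping.lookup f (Poly_Mapping.map_key (perm_var \<sigma>) t)"
  by (simp add: perm_poly_def map_key.rep_eq inj_map_key_perm_var[OF assms])

lemma perm_poly_Var:
  assumes "bij \<sigma>"
  shows "perm_poly \<sigma> (Var v) = Var (perm_var \<sigma> v)"
proof -
  have *: "Poly_Mapping.map_key (perm_var \<sigma>) (Poly_Mapping.single (perm_var \<sigma> v) (1::nat)) =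
      Poly_Mapping.single v 1"
    using bij_perm_var[OF assms] by (simp add: bij_is_inj)
  show ?thesis
    unfolding perm_poly_def Var_def
    using map_key_single[OF inj_map_key_perm_var[OF assms],
        of "Poly_Mapping.single (perm_var \<sigma> v) 1" "1 :: complex"] *
    by simp
qed

definition sgn_char :: "nat \<Rightarrow> ('n \<Rightarrow> 'n) \<Rightarrow> int" where
  "sgn_char d \<sigma> = (if even d then 1 else sign \<sigma>)"

text \<open>
  The space of polynomials identified with the global sections of \<open>\<O>(m, k)\<close> on
  \<open>Hilb\<^sup>n\<^sup>,\<^sup>n\<^sup>+\<^sup>1(\<complex>\<^sup>2)\<close>: the \<open>sgn(m + k)\<close>-component of \<open>J\<^sup>m\<^sup>+\<^sup>k \<inter> I\<^sup>k\<close>.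
\<close>

definition nested_hilb_sections :: "nat \<Rightarrow> nat \<Rightarrow> 'n::{finite,linorder} cpoly set" where
  "nested_hilb_sections m k =
    {f \<in> ideal_pow ideal_J (m + k) \<inter> ideal_pow ideal_I k.
      \<forall>\<sigma>. \<sigma> permutes UNIV \<longrightarrow> perm_poly \<sigma> f = of_int (sgn_char (m + k) \<sigma>) * f}"

text \<open>
  The trailing exponent of a nonzero \<open>f\<close>. The linear order on \<open>'v \<Rightarrow>\<^sub>0 nat\<close> from
  \<open>Poly_Mapping\<close> is the lexicographic order in which the smallest variable is the most
  significant one.
\<close>

definition trailing_exp :: "'n::{finite,linorder} cpoly \<Rightarrow> 'n var \<Rightarrow>\<^sub>0 nat" where
  "trailing_exp f = Min (Poly_Mapping.keys f)"

text \<open>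
  The valuation, with \<open>\<real>\<^sup>2\<^sup>n\<^sup>+\<^sup>2\<close> written as \<open>\<real> \<times> \<real> \<times> \<real>\<^sup>n \<times> \<real>\<^sup>n\<close> in the coordinates
  \<open>(a, b, (a\<^sub>1, ..., a\<^sub>n), (b\<^sub>1, ..., b\<^sub>n))\<close>.
\<close>

definition nu :: "'n::{finite,linorder} cpoly \<Rightarrow> real \<times> real \<times> (real ^ 'n::{finite,linorder}) \<times> (real ^ 'n::{finite,linorder})" where
  "nu f = (let e = Poly_Mapping.lookup (trailing_exp f) in
    (real (e Vx), real (e Vy), (\<chi> i. real (e (Vxi i))), (\<chi> i. real (e (Vyi i)))))"

text \<open>
  The Newton-Okounkov body of a line bundle \<open>\<L>\<close>, where \<open>V d\<close> is the section space of
  \<open>\<L>\<^sup>\<otimes>\<^sup>d\<close>.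
\<close>

definition newton_okounkov_body ::
    "(nat \<Rightarrow> 'n::{finite,linorder} cpoly set) \<Rightarrow> (real \<times> real \<times> (real ^ 'n::{finite,linorder}) \<times> (real ^ 'n::{finite,linorder})) set" where
  "newton_okounkov_body V =
    closure (convex hull (\<Union>d\<in>{1..}. (\<lambda>f. (1 / real d) *\<^sub>R nu f) ` (V d - {0})))"

definition Delta :: "real \<Rightarrow> real \<Rightarrow> ((real ^ 'n::{finite,linorder}) \<times> (real ^ 'n::{finite,linorder})) set" where
  "Delta p q = {(a, b).
    (\<forall>i. 0 \<le> a $ i) \<and> (\<forall>i j. i \<le> j \<longrightarrow> a $ i \<le> a $ j) \<and>
    (\<forall>j. b $ j \<ge> max (q - a $ j) 0 + (\<Sum>i\<in>{..<j}. max (p - (a $ j - a $ i)) 0))}"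

end

theory Submission
  imports Defs "HOL-Library.Option_ord"
begin

text \<open>
  Write \<open>P = d (m + k)\<close> and \<open>K = d k\<close> for the exponents of \<open>J\<close> and \<open>I\<close> in degree \<open>d\<close>. The
  closed convex hull is computed by comparing, for every \<open>d\<close>, the trailing exponents of
  sections with the lattice points of the polyhedron \<open>d \<Delta>\<close>.

  Every trailing exponent satisfies the inequalities. Let \<open>f\<close> be a section and let \<open>a\<^sub>i\<close>,
  \<open>b\<^sub>i\<close> be the exponents of \<open>x\<^sub>i\<close>, \<open>y\<^sub>i\<close> in its trailing monomial. Symmetry up to sign makes
  the \<open>a\<^sub>i\<close> increasing. The coefficient \<open>h\<close> in \<open>\<complex>[y\<^sub>1, ..., y\<^sub>n]\<close> of the smallest monomial
  in the other variables has the trailing monomial with exponents \<open>b\<^sub>i\<close>. Since \<open>f\<close> lies in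
  \<open>(x\<^sub>i - x\<^sub>j, y\<^sub>i - y\<^sub>j)\<^sup>P\<close>, the power of \<open>y\<^sub>i - y\<^sub>j\<close> with exponent \<open>max (P - (a\<^sub>j - a\<^sub>i))
  0\<close> divides \<open>h\<close> for \<open>i < j\<close> (lemma \<open>difference_power_dvd_y_part\<close>); since \<open>f\<close> lies in \<open>(x\<^sub>j
  - x, y\<^sub>j - y)\<^sup>K\<close>, so does the power of \<open>y\<^sub>j\<close> with exponent \<open>max (K - a\<^sub>j) 0\<close> (lemma
  \<open>variable_power_dvd_y_part\<close>). For fixed \<open>j\<close> these are powers of distinct primes, hence
  their product divides \<open>h\<close>. For \<open>i < j\<close> the trailing monomial of \<open>y\<^sub>i - y\<^sub>j\<close> is \<open>y\<^sub>j\<close>, and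
  trailing exponents add up under multiplication, so \<open>b\<^sub>j\<close> is at least the sum of these
  exponents (lemma \<open>trailing_exp_section_bound\<close>). The polyhedron is closed and convex, so it
  contains the body.

  Conversely, every lattice point of \<open>d \<Delta>\<close>, together with any exponents of \<open>x\<close> and
  \<open>y\<close>, is a trailing exponent up to a translation that does not depend on \<open>d\<close> (lemma
  \<open>exists_section_with_trailing_exp\<close>). Alternating polynomials \<open>det(x\<^sub>i\<^sup>c y\<^sub>i\<^sup>e)\<close> in the \<open>n\<close>
  points \<open>(x\<^sub>i, y\<^sub>i)\<close> lie in \<open>J\<close>, those in the \<open>n + 1\<close> points including \<open>(x, y)\<close> lie in \<open>J\<close>
  and in \<open>I\<close>, and their trailing monomials are the diagonal ones. So a product of \<open>d m\<close> of
  the first kind and \<open>d k\<close> of the second kind is a section, and so are its multiples by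
  symmetric polynomials. To get the exponents \<open>a\<^sub>j\<close> from \<open>P\<close> factors as economically as
  possible in the \<open>y\<^sub>j\<close>, the \<open>r\<close>-th factor gets the \<open>x\<close>-exponents \<open>c\<^sub>j = \<lfloor>(a\<^sub>j + r) / P\<rfloor>\<close>,
  which sum up to \<open>a\<^sub>j\<close> by Hermite's identity. The exponent of \<open>y\<^sub>j\<close> counts the earlier
  points with the same \<open>x\<close>-exponent; the values for \<open>i < j\<close> agree in at most \<open>max (P - (a\<^sub>j
  - a\<^sub>i)) 0\<close> of the factors, and \<open>c\<^sub>j = 0\<close> in at most \<open>max (K - a\<^sub>j) 0\<close> of the factors of
  the second kind. Letting \<open>d\<close> tend to infinity, every point of the polyhedron is a limit of
  scaled trailing exponents.
\<close>

section \<open>Polynomials as sums of monomials\<close>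

lemma poly_mapping_sum_single:
  "f = (\<Sum>s\<in>Poly_Mapping.keys f. Poly_Mapping.single s (Poly_Mapping.lookup f s))"
  by (rule poly_mapping_eqI) (auto simp: lookup_sum lookup_single when_def in_keys_iff)

lemma lookup_mult_keys:
  "Poly_Mapping.lookup (f * g) k =
    (\<Sum>s\<in>Poly_Mapping.keys f. \<Sum>t\<in>Poly_Mapping.keys g.
      (Poly_Mapping.lookup f s * Poly_Mapping.lookup g t when s + t = k))"
  for f g :: "'m::comm_monoid_add \<Rightarrow>\<^sub>0 'c::comm_semiring_1"
proof -
  have "f * g = (\<Sum>s\<in>Poly_Mapping.keys f. \<Sum>t\<in>Poly_Mapping.keys g.
      Poly_Mapping.single (s + t) (Poly_Mapping.lookup f s * Poly_Mapping.lookup g t))"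
    by (subst (1) poly_mapping_sum_single[of f], subst (1) poly_mapping_sum_single[of g])
      (simp add: sum_product mult_single)
  then show ?thesis
    by (simp add: lookup_sum lookup_single)
qed

lemma lookup_single_zero_mult:
  "Poly_Mapping.lookup (Poly_Mapping.single 0 c * f) k = c * Poly_Mapping.lookup f k"
  for f :: "'m::comm_monoid_add \<Rightarrow>\<^sub>0 'c::comm_semiring_1"
proof -
  have "Poly_Mapping.single 0 c * f =
      (\<Sum>s\<in>Poly_Mapping.keys f. Poly_Mapping.single s (c * Poly_Mapping.lookup f s))"
    by (subst (1) poly_mapping_sum_single[of f]) (simp add: sum_distrib_left mult_single)
  then show ?thesis
    by (auto simp: lookup_sum lookup_single when_def in_keys_iff)
qed


text \<open>
  The ring homomorphisms out of a monoid algebra used below are given by their values on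
  coefficients and on monomials.
\<close>

locale monomial_hom =
  fixes \<iota> :: "'c::comm_ring_1 \<Rightarrow> 'r::comm_ring_1" and \<theta> :: "'m::comm_monoid_add \<Rightarrow> 'r"
  assumes coeff_zero: "\<iota> 0 = 0"
    and coeff_one: "\<iota> 1 = 1"
    and coeff_add: "\<iota> (c + d) = \<iota> c + \<iota> d"
    and coeff_mult: "\<iota> (c * d) = \<iota> c * \<iota> d"
    and monom_zero: "\<theta> 0 = 1"
    and monom_add: "\<theta> (s + t) = \<theta> s * \<theta> t"
begin

definition lift :: "('m \<Rightarrow>\<^sub>0 'c) \<Rightarrow> 'r" where
  "lift f = (\<Sum>s\<in>Poly_Mapping.keys f. \<iota> (Poly_Mapping.lookup f s) * \<theta> s)"

lemma lift_superset:
  assumes "finite S" "Poly_Mapping.keys f \<subseteq> S"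
  shows "lift f = (\<Sum>s\<in>S. \<iota> (Poly_Mapping.lookup f s) * \<theta> s)"
  unfolding lift_def
  by (rule sum.mono_neutral_left) (use assms in \<open>auto simp: in_keys_iff coeff_zero\<close>)

lemma lift_zero: "lift 0 = 0"
  by (simp add: lift_def)

lemma lift_add: "lift (f + g) = lift f + lift g"
proof -
  let ?S = "Poly_Mapping.keys f \<union> Poly_Mapping.keys g"
  have "lift (f + g) = (\<Sum>s\<in>?S. \<iota> (Poly_Mapping.lookup (f + g) s) * \<theta> s)"
    by (rule lift_superset) (auto simp: Poly_Mapping.keys_add)
  also have "\<dots> = (\<Sum>s\<in>?S. \<iota> (Poly_Mapping.lookup f s) * \<theta> s) +
      (\<Sum>s\<in>?S. \<iota> (Poly_Mapping.lookup g s) * \<theta> s)"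
    by (simp add: lookup_add coeff_add distrib_right sum.distrib)
  also have "\<dots> = lift f + lift g"
    using lift_superset[of ?S f] lift_superset[of ?S g] by simp
  finally show ?thesis .
qed

lemma lift_sum: "lift (sum F S) = (\<Sum>s\<in>S. lift (F s))"
  by (induction S rule: infinite_finite_induct) (simp_all add: lift_zero lift_add)

lemma lift_single: "lift (Poly_Mapping.single s c) = \<iota> c * \<theta> s"
  by (subst lift_superset[of "{s}"]) auto

lemma lift_mult: "lift (f * g) = lift f * lift g"
proof -
  have "lift (f * g) = lift (\<Sum>s\<in>Poly_Mapping.keys f. \<Sum>t\<in>Poly_Mapping.keys g.
      Poly_Mapping.single (s + t) (Poly_Mapping.lookup f s * Poly_Mapping.lookup g t))"
    by (subst (1) poly_mapping_sum_single[of f], subst (1) poly_mapping_sum_single[of g])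
      (simp add: sum_product mult_single)
  also have "\<dots> = lift f * lift g"
    unfolding lift_sum lift_single coeff_mult monom_add
    by (simp add: lift_def sum_product mult_ac)
  finally show ?thesis .
qed

lemma lift_uminus: "lift (- f) = - lift f"
  using lift_add[of f "- f"] by (simp add: lift_zero eq_neg_iff_add_eq_0 add.commute)

lemma lift_diff: "lift (f - g) = lift f - lift g"
  using lift_add[of f "- g"] by (simp add: lift_uminus)

lemma lift_one: "lift 1 = 1"
  using lift_single[of 0 1] by (simp add: coeff_one monom_zero)

end

lemma Var_power: "Var v ^ k = Poly_Mapping.single (Poly_Mapping.single v k) 1"
  by (induction k) (simp_all add: Var_def mult_single flip: single_add)

lemma prod_single:
  "(\<Prod>i\<in>A. Poly_Mapping.single (T i) (1::'c::comm_semiring_1)) = Poly_Mapping.single (\<Sum>i\<in>A. T i) 1"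
  for T :: "'i \<Rightarrow> 'm::comm_monoid_add"
  by (induction A rule: infinite_finite_induct) (simp_all add: mult_single)

section \<open>Trailing exponents\<close>

lemma less_poly_mappingI:
  fixes s t :: "'v::linorder \<Rightarrow>\<^sub>0 nat"
  assumes "Poly_Mapping.lookup s v < Poly_Mapping.lookup t v"
    and "\<And>w. w < v \<Longrightarrow> Poly_Mapping.lookup s w = Poly_Mapping.lookup t w"
  shows "s < t"
  using assms unfolding less_poly_mapping.rep_eq less_fun_def by blast

lemma less_poly_mappingE:
  fixes s t :: "'v::linorder \<Rightarrow>\<^sub>0 nat"
  assumes "s < t"
  obtains v where "Poly_Mapping.lookup s v < Poly_Mapping.lookup t v"
    and "\<And>w. w < v \<Longrightarrow> Poly_Mapping.lookup s w = Poly_Mapping.lookup t w"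
  using assms unfolding less_poly_mapping.rep_eq less_fun_def by blast

lemma trailing_exp_in_keys: "f \<noteq> 0 \<Longrightarrow> trailing_exp f \<in> Poly_Mapping.keys f"
  unfolding trailing_exp_def by (rule Min_in) (auto simp: poly_mapping_eq_iff fun_eq_iff in_keys_iff)

lemma trailing_exp_le: "s \<in> Poly_Mapping.keys f \<Longrightarrow> trailing_exp f \<le> s"
  unfolding trailing_exp_def by (rule Min_le) auto

lemma trailing_exp_eqI:
  assumes "t \<in> Poly_Mapping.keys f" "\<And>s. s \<in> Poly_Mapping.keys f \<Longrightarrow> t \<le> s"
  shows "trailing_exp f = t"
  unfolding trailing_exp_def by (rule Min_eqI) (use assms in auto)

lemma trailing_exp_single: "c \<noteq> 0 \<Longrightarrow> trailing_exp (Poly_Mapping.single t c) = t"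
  by (simp add: trailing_exp_def)

lemma trailing_exp_one: "trailing_exp 1 = 0"
  by (simp add: trailing_exp_def)

text \<open>
  The exponent order is compatible with addition, so the product of the two smallest
  monomials is reached by no other pair of monomials and cannot cancel.
\<close>

lemma trailing_exp_mult:
  fixes f g :: "'n::{finite,linorder} cpoly"
  assumes f: "f \<noteq> 0" and g: "g \<noteq> 0"
  shows "trailing_exp (f * g) = trailing_exp f + trailing_exp g"
proof (rule trailing_exp_eqI)
  let ?s = "trailing_exp f" and ?t = "trailing_exp g"
  have eq: "s = ?s \<and> t = ?t" if "s \<in> Poly_Mapping.keys f" "t \<in> Poly_Mapping.keys g" "s + t = ?s + ?t" for s t
  proof -
    have 1: "?s \<le> s" "?t \<le> t" using that trailing_exp_le by auto
    then have "\<not> ?s < s" using that(3) add_less_le_mono[of ?s s ?t t] by (metis less_irrefl)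
    moreover from 1 have "\<not> ?t < t" using that(3) add_le_less_mono[of ?s s ?t t] by (metis less_irrefl)
    ultimately show ?thesis using 1 by (auto simp: order.order_iff_strict)
  qed
  have "Poly_Mapping.lookup (f * g) (?s + ?t) =
    (\<Sum>s\<in>Poly_Mapping.keys f. \<Sum>t\<in>Poly_Mapping.keys g.
      if s = ?s then if t = ?t then Poly_Mapping.lookup f s * Poly_Mapping.lookup g t else 0 else 0)"
    unfolding lookup_mult_keys by (intro sum.cong refl) (use eq in \<open>auto simp: when_def\<close>)
  also have "\<dots> = (\<Sum>s\<in>Poly_Mapping.keys f. if s = ?s then
      \<Sum>t\<in>Poly_Mapping.keys g. if t = ?t then Poly_Mapping.lookup f s * Poly_Mapping.lookup g t else 0 else 0)"
    by (intro sum.cong refl) auto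
  also have "\<dots> = Poly_Mapping.lookup f ?s * Poly_Mapping.lookup g ?t"
    using trailing_exp_in_keys[OF f] trailing_exp_in_keys[OF g] by simp
  finally show "?s + ?t \<in> Poly_Mapping.keys (f * g)"
    using trailing_exp_in_keys[OF f] trailing_exp_in_keys[OF g] by (simp add: in_keys_iff)
next
  fix u assume "u \<in> Poly_Mapping.keys (f * g)"
  then obtain s t where "u = s + t" "s \<in> Poly_Mapping.keys f" "t \<in> Poly_Mapping.keys g"
    using keys_mult[of f g] by blast
  then show "trailing_exp f + trailing_exp g \<le> u"
    using trailing_exp_le by (metis add_mono)
qed

lemma trailing_exp_prod:
  fixes F :: "'i \<Rightarrow> 'n::{finite,linorder} cpoly"
  assumes "\<And>i. i \<in> A \<Longrightarrow> F i \<noteq> 0"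
  shows "trailing_exp (\<Prod>i\<in>A. F i) = (\<Sum>i\<in>A. trailing_exp (F i))"
  using assms
proof (induction A rule: infinite_finite_induct)
  case (insert i A)
  then have "(\<Prod>i\<in>A. F i) \<noteq> 0" by simp
  with insert show ?case by (simp add: trailing_exp_mult)
qed (simp_all add: trailing_exp_one)

lemma trailing_exp_power:
  fixes f :: "'n::{finite,linorder} cpoly"
  assumes "f \<noteq> 0"
  shows "Poly_Mapping.lookup (trailing_exp (f ^ k)) v = k * Poly_Mapping.lookup (trailing_exp f) v"
  using assms by (induction k) (simp_all add: trailing_exp_one trailing_exp_mult lookup_add)

section \<open>Ideals and their powers\<close>

interpretation ring_module: module "(*) :: 'a::comm_ring_1 \<Rightarrow> 'a \<Rightarrow> 'a"
  by (rule module_times)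

lemma ideal_gen_pair_iff:
  "f \<in> ideal_gen {u, v} \<longleftrightarrow> (\<exists>r s. f = r * u + s * v)"
proof -
  have "f \<in> ideal_gen {u, v} \<longleftrightarrow> (\<exists>r s. f - r * u - s * v = 0)"
    unfolding ideal_gen_def ring_module.span_insert ring_module.span_empty
    by (auto simp: Bex_def)
  also have "\<dots> \<longleftrightarrow> (\<exists>r s. f = r * u + s * v)"
    by (simp add: algebra_simps)
  finally show ?thesis .
qed

lemma ideal_gen_mult: "a \<in> ideal_gen S \<Longrightarrow> r * a \<in> ideal_gen S"
  unfolding ideal_gen_def by (rule ring_module.span_scale)

lemma ideal_gen_add: "a \<in> ideal_gen S \<Longrightarrow> b \<in> ideal_gen S \<Longrightarrow> a + b \<in> ideal_gen S"
  unfolding ideal_gen_def by (rule ring_module.span_add)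

lemma ideal_gen_zero: "0 \<in> ideal_gen S"
  unfolding ideal_gen_def by (rule ring_module.span_zero)

lemma ideal_gen_sum: "(\<And>i. i \<in> A \<Longrightarrow> F i \<in> ideal_gen S) \<Longrightarrow> sum F A \<in> ideal_gen S"
  unfolding ideal_gen_def by (rule ring_module.span_sum)

lemma ideal_pow_mult: "a \<in> ideal_pow A d \<Longrightarrow> r * a \<in> ideal_pow A d"
  by (cases d) (simp_all add: ideal_gen_mult)

lemma prod_in_ideal_pow:
  assumes "finite S" "\<And>i. i \<in> S \<Longrightarrow> F i \<in> A"
  shows "(\<Prod>i\<in>S. F i) \<in> ideal_pow A (card S)"
  using assms
proof (induction S rule: finite_induct)
  case (insert i S)
  then have "F i * (\<Prod>i\<in>S. F i) \<in> {a * b | a b. a \<in> A \<and> b \<in> ideal_pow A (card S)}" by auto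
  with insert show ?case
    by (auto simp: ideal_gen_def intro: ring_module.span_base)
qed auto

text \<open>
  The tool for exploiting membership in a power of an ideal: a ring homomorphism that sends
  the ideal into the first step of a multiplicative filtration sends the powers into the
  corresponding steps.
\<close>

lemma ideal_pow_filtration:
  fixes \<phi> :: "'a::comm_ring_1 \<Rightarrow> 'b::comm_ring_1" and V :: "nat \<Rightarrow> 'b set"
  assumes zero: "\<phi> 0 = 0"
    and add: "\<And>f g. \<phi> (f + g) = \<phi> f + \<phi> g"
    and mult: "\<And>f g. \<phi> (f * g) = \<phi> f * \<phi> g"
    and V_zero: "\<And>d. 0 \<in> V d"
    and V_add: "\<And>d p q. p \<in> V d \<Longrightarrow> q \<in> V d \<Longrightarrow> p + q \<in> V d"
    and V_mult: "\<And>d e p q. p \<in> V d \<Longrightarrow> q \<in> V e \<Longrightarrow> p * q \<in> V (d + e)"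
    and V_UNIV: "V 0 = UNIV"
    and base: "\<And>a. a \<in> A \<Longrightarrow> \<phi> a \<in> V 1"
    and f: "f \<in> ideal_pow A d"
  shows "\<phi> f \<in> V d"
  using f
proof (induction d arbitrary: f)
  case 0
  then show ?case by (simp add: V_UNIV)
next
  case (Suc d)
  have "f \<in> module.span (*) {a * b | a b. a \<in> A \<and> b \<in> ideal_pow A d}"
    using Suc.prems by (simp add: ideal_gen_def)
  then show ?case
  proof (induction rule: ring_module.span_induct_alt)
    case base
    then show ?case by (simp add: zero V_zero)
  next
    case (step c x y)
    then obtain a b where x: "x = a * b" "a \<in> A" "b \<in> ideal_pow A d" by blast
    have "\<phi> a * \<phi> b \<in> V (1 + d)"
      using x Suc.IH base by (intro V_mult) auto
    have "\<phi> c * (\<phi> a * \<phi> b) \<in> V (0 + (1 + d))"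
      by (rule V_mult) (use V_UNIV \<open>\<phi> a * \<phi> b \<in> V (1 + d)\<close> in auto)
    with step show ?case by (auto simp: add mult x intro!: V_add)
  qed
qed

section \<open>The permutation action\<close>

lemma lookup_map_key_perm_var:
  assumes "bij \<sigma>"
  shows "Poly_Mapping.lookup (Poly_Mapping.map_key (perm_var \<sigma>) s) v = Poly_Mapping.lookup s (perm_var \<sigma> v)"
  using bij_perm_var[OF assms] by (simp add: map_key.rep_eq bij_is_inj)

lemma perm_var_inv:
  assumes "bij \<sigma>"
  shows "perm_var \<sigma> (perm_var (inv \<sigma>) v) = v" "perm_var (inv \<sigma>) (perm_var \<sigma> v) = v"
  using assms by (cases v; simp add: bij_is_inj bij_is_surj surj_f_inv_f)+

lemma map_key_perm_var_eq_iff: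
  assumes "bij \<sigma>"
  shows "Poly_Mapping.map_key (perm_var (inv \<sigma>)) s = t \<longleftrightarrow> s = Poly_Mapping.map_key (perm_var \<sigma>) t"
  unfolding poly_mapping_eq_iff fun_eq_iff lookup_map_key_perm_var[OF assms]
    lookup_map_key_perm_var[OF bij_imp_bij_inv[OF assms]]
  by (metis perm_var_inv[OF assms])

lemma monomial_hom_perm:
  assumes "bij \<sigma>"
  shows "monomial_hom (\<lambda>c::complex. Poly_Mapping.single (0::'n var \<Rightarrow>\<^sub>0 nat) c)
    (\<lambda>s. Poly_Mapping.single (Poly_Mapping.map_key (perm_var (inv \<sigma>)) s) 1)"
proof -
  have "inj (perm_var (inv \<sigma>))"
    using assms by (simp add: bij_imp_bij_inv bij_is_inj bij_perm_var)
  then show ?thesis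
    by unfold_locales (simp_all add: single_add mult_single map_key_plus)
qed

lemma perm_poly_eq_lift:
  assumes "bij \<sigma>"
  shows "perm_poly \<sigma> = monomial_hom.lift (\<lambda>c::complex. Poly_Mapping.single (0::'n var \<Rightarrow>\<^sub>0 nat) c)
    (\<lambda>s. Poly_Mapping.single (Poly_Mapping.map_key (perm_var (inv \<sigma>)) s) 1)"
proof (intro ext poly_mapping_eqI)
  fix f :: "'n cpoly" and t
  interpret monomial_hom "\<lambda>c::complex. Poly_Mapping.single (0::'n var \<Rightarrow>\<^sub>0 nat) c"
    "\<lambda>s. Poly_Mapping.single (Poly_Mapping.map_key (perm_var (inv \<sigma>)) s) 1"
    by (rule monomial_hom_perm[OF assms])
  show "Poly_Mapping.lookup (perm_poly \<sigma> f) t = Poly_Mapping.lookup (lift f) t"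
    by (auto simp: lookup_perm_poly[OF assms] lift_def lookup_sum mult_single lookup_single when_def
        map_key_perm_var_eq_iff[OF assms] in_keys_iff)
qed

lemma perm_poly_mult:
  assumes "bij \<sigma>"
  shows "perm_poly \<sigma> (f * g) = perm_poly \<sigma> f * perm_poly \<sigma> g"
  unfolding perm_poly_eq_lift[OF assms] by (rule monomial_hom.lift_mult[OF monomial_hom_perm[OF assms]])

lemma perm_poly_sum:
  assumes "bij \<sigma>"
  shows "perm_poly \<sigma> (sum F A) = (\<Sum>i\<in>A. perm_poly \<sigma> (F i))"
  unfolding perm_poly_eq_lift[OF assms] by (rule monomial_hom.lift_sum[OF monomial_hom_perm[OF assms]])

lemma perm_poly_one:
  assumes "bij \<sigma>"
  shows "perm_poly \<sigma> 1 = 1"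
  unfolding perm_poly_eq_lift[OF assms] by (rule monomial_hom.lift_one[OF monomial_hom_perm[OF assms]])

lemma perm_poly_uminus:
  assumes "bij \<sigma>"
  shows "perm_poly \<sigma> (- f) = - perm_poly \<sigma> f"
  unfolding perm_poly_eq_lift[OF assms] by (rule monomial_hom.lift_uminus[OF monomial_hom_perm[OF assms]])

lemma perm_poly_prod:
  assumes "bij \<sigma>"
  shows "perm_poly \<sigma> (prod F A) = (\<Prod>i\<in>A. perm_poly \<sigma> (F i))"
  by (induction A rule: infinite_finite_induct) (simp_all add: perm_poly_one perm_poly_mult assms)

lemma perm_poly_power:
  assumes "bij \<sigma>"
  shows "perm_poly \<sigma> (f ^ k) = perm_poly \<sigma> f ^ k"
  by (induction k) (simp_all add: perm_poly_one perm_poly_mult assms)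


section \<open>Restriction of exponents\<close>

definition restr :: "'v::finite set \<Rightarrow> ('v \<Rightarrow>\<^sub>0 nat) \<Rightarrow> 'v \<Rightarrow>\<^sub>0 nat" where
  "restr W s = (\<Sum>v\<in>W. Poly_Mapping.single v (Poly_Mapping.lookup s v))"

lemma lookup_restr: "Poly_Mapping.lookup (restr W s) v = (if v \<in> W then Poly_Mapping.lookup s v else 0)"
  by (simp add: restr_def lookup_sum lookup_single when_def)

lemma restr_zero: "restr W 0 = 0"
  by (rule poly_mapping_eqI) (simp add: lookup_restr)

lemma restr_add: "restr W (s + t) = restr W s + restr W t"
  by (rule poly_mapping_eqI) (simp add: lookup_restr lookup_add)

lemma restr_single: "restr W (Poly_Mapping.single v k) = (if v \<in> W then Poly_Mapping.single v k else 0)"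
  by (rule poly_mapping_eqI) (auto simp: lookup_restr lookup_single when_def)

lemma poly_mapping_le_lookup:
  fixes s t :: "'v::linorder \<Rightarrow>\<^sub>0 nat"
  assumes "t \<le> s" "\<And>w. w < v \<Longrightarrow> Poly_Mapping.lookup t w = Poly_Mapping.lookup s w"
  shows "Poly_Mapping.lookup t v \<le> Poly_Mapping.lookup s v"
  using assms less_poly_mappingI[of s v t] by (metis leD leI)

section \<open>Order of vanishing where two points collide\<close>

lemma keys_perm_closed:
  assumes f: "perm_poly \<sigma> f = of_int (sgn_char d \<sigma>) * f" and bij: "bij \<sigma>"
    and s: "s \<in> Poly_Mapping.keys f"
  shows "Poly_Mapping.map_key (perm_var \<sigma>) s \<in> Poly_Mapping.keys f"
proof -
  have "Poly_Mapping.lookup f (Poly_Mapping.map_key (perm_var \<sigma>) s) =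
      Poly_Mapping.lookup (of_int (sgn_char d \<sigma>) * f) s"
    using lookup_perm_poly[OF bij, of f s] f by simp
  also have "\<dots> = of_int (sgn_char d \<sigma>) * Poly_Mapping.lookup f s"
    by (simp add: lookup_single_zero_mult flip: single_of_int)
  also have "\<dots> \<noteq> 0"
    using s by (simp add: in_keys_iff sgn_char_def sign_def)
  finally show ?thesis by (simp add: in_keys_iff)
qed

lemma Vxi_before: "w < Vxi i \<Longrightarrow> w = Vx \<or> w = Vy \<or> (\<exists>l<i. w = Vxi l)"
  by (cases w) (auto simp: less_var_def not_le)

text \<open>
  Exchanging the \<open>i\<close>-th and the \<open>j\<close>-th point in the trailing monomial gives another monomial of
  \<open>f\<close>; if the \<open>x\<close>-exponents were decreasing, this one would be smaller.
\<close>

lemma trailing_exp_mono: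
  fixes f :: "'n::{finite,linorder} cpoly"
  assumes f: "\<And>\<sigma>. \<sigma> permutes UNIV \<Longrightarrow> perm_poly \<sigma> f = of_int (sgn_char d \<sigma>) * f"
    and "f \<noteq> 0" and "i \<le> j"
  shows "Poly_Mapping.lookup (trailing_exp f) (Vxi i) \<le> Poly_Mapping.lookup (trailing_exp f) (Vxi j)"
proof -
  define \<tau> where "\<tau> = Transposition.transpose i j"
  have "\<tau> permutes UNIV" by (simp add: \<tau>_def permutes_swap_id)
  then have bij: "bij \<tau>" by (rule permutes_bij)
  have "trailing_exp f \<le> Poly_Mapping.map_key (perm_var \<tau>) (trailing_exp f)"
    using trailing_exp_in_keys[OF \<open>f \<noteq> 0\<close>] f[OF \<open>\<tau> permutes UNIV\<close>]
    by (intro trailing_exp_le keys_perm_closed[OF _ bij])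
  then have "Poly_Mapping.lookup (trailing_exp f) (Vxi i) \<le>
      Poly_Mapping.lookup (Poly_Mapping.map_key (perm_var \<tau>) (trailing_exp f)) (Vxi i)"
  proof (rule poly_mapping_le_lookup)
    fix w assume "w < Vxi i"
    with \<open>i \<le> j\<close> have "perm_var \<tau> w = w"
      by (auto dest!: Vxi_before simp: \<tau>_def Transposition.transpose_def)
    then show "Poly_Mapping.lookup (trailing_exp f) w =
        Poly_Mapping.lookup (Poly_Mapping.map_key (perm_var \<tau>) (trailing_exp f)) w"
      by (simp add: lookup_map_key_perm_var[OF bij])
  qed
  moreover have "perm_var \<tau> (Vxi i) = Vxi j" by (simp add: \<tau>_def)
  ultimately show ?thesis by (simp add: lookup_map_key_perm_var[OF bij])
qed

text \<open>
  The binomial coefficients \<open>k choose e\<close> with \<open>e \<le> L\<close> span the polynomials of degree at most \<open>L\<close>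
  in \<open>k\<close>; the combination wanted here is the Lagrange polynomial at \<open>a\<close> for the \<open>L + 1\<close> nodes
  \<open>a, ..., a + L\<close>.
\<close>

lemma interpolate_by_binomials:
  "\<exists>coef::nat \<Rightarrow> complex. \<forall>k::nat. a \<le> k \<longrightarrow> k \<le> a + L \<longrightarrow>
    (\<Sum>e\<le>L. coef e * of_nat (k choose e)) = (if k = a then 1 else 0)"
proof -
  have "\<exists>coef::nat \<Rightarrow> complex. \<forall>k::nat.
      (\<Prod>r<L. of_nat (a + Suc r) - of_nat k) = (\<Sum>e\<le>L. coef e * of_nat (k choose e))"
  proof (induction L)
    case 0
    show ?case by (intro exI[of _ "\<lambda>_. 1"]) simp
  next
    case (Suc L)
    then obtain coef :: "nat \<Rightarrow> complex" where coef: "\<And>k::nat.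
      (\<Prod>r<L. of_nat (a + Suc r) - of_nat k) = (\<Sum>e\<le>L. coef e * of_nat (k choose e))" by blast
    define c :: complex where "c = of_nat (a + Suc L)"
    \<comment> \<open>Multiplication by \<open>c - k\<close> in the basis of binomial coefficients:
      \<open>k * (k choose e) = e * (k choose e) + (e + 1) * (k choose (e + 1))\<close>.\<close>
    define \<mu> where "\<mu> e = (if e \<le> L then coef e * (c - of_nat e) else 0) -
      (if e = 0 then 0 else coef (e - 1) * of_nat e)" for e
    have "(\<Prod>r<Suc L. of_nat (a + Suc r) - of_nat k) = (\<Sum>e\<le>Suc L. \<mu> e * of_nat (k choose e))" for k :: nat
    proof -
      have step: "of_nat k * of_nat (k choose e) =
          (of_nat e * of_nat (k choose e) + of_nat (Suc e) * of_nat (k choose Suc e) :: complex)" for e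
        using gbinomial_mult_1[of "of_nat k :: complex" e] by (simp add: binomial_gbinomial)
      have "(\<Prod>r<Suc L. of_nat (a + Suc r) - of_nat k) =
          (\<Sum>e\<le>L. coef e * of_nat (k choose e) * (c - of_nat k))"
        by (simp only: prod.lessThan_Suc coef c_def sum_distrib_right)
      also have "\<dots> = (\<Sum>e\<le>L. coef e * (c - of_nat e) * of_nat (k choose e)) -
          (\<Sum>e\<le>L. coef e * of_nat (Suc e) * of_nat (k choose Suc e))"
        unfolding sum_subtractf[symmetric]
      proof (intro sum.cong refl)
        fix e
        have "coef e * of_nat (k choose e) * (c - of_nat k) =
            coef e * (c * of_nat (k choose e)) - coef e * (of_nat k * of_nat (k choose e))"
          by (simp only: right_diff_distrib left_diff_distrib mult_ac)
        then show "coef e * of_nat (k choose e) * (c - of_nat k) =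
            coef e * (c - of_nat e) * of_nat (k choose e) - coef e * of_nat (Suc e) * of_nat (k choose Suc e)"
          unfolding step by (simp only: right_diff_distrib left_diff_distrib distrib_left mult_ac diff_diff_eq)
      qed
      also have "(\<Sum>e\<le>L. coef e * (c - of_nat e) * of_nat (k choose e)) =
          (\<Sum>e\<le>Suc L. (if e \<le> L then coef e * (c - of_nat e) else 0) * of_nat (k choose e))"
        by simp
      also have "(\<Sum>e\<le>L. coef e * of_nat (Suc e) * of_nat (k choose Suc e)) =
          (\<Sum>e\<le>Suc L. (if e = 0 then 0 else coef (e - 1) * of_nat e) * of_nat (k choose e))"
        by (subst sum.atMost_Suc_shift) simp
      finally show ?thesis
        by (simp only: \<mu>_def left_diff_distrib sum_subtractf)
    qed
    then show ?case by blast
  qed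
  then obtain coef :: "nat \<Rightarrow> complex" where coef: "\<And>k::nat.
      (\<Prod>r<L. of_nat (a + Suc r) - of_nat k) = (\<Sum>e\<le>L. coef e * of_nat (k choose e))" by blast
  have "(\<Sum>e\<le>L. coef e / fact L * of_nat (k choose e)) = (if k = a then 1 else 0)"
    if k: "a \<le> k" "k \<le> a + L" for k
  proof -
    have "(\<Sum>e\<le>L. coef e / fact L * of_nat (k choose e)) = (\<Prod>r<L. of_nat (a + Suc r) - of_nat k) / fact L"
      unfolding coef by (simp add: sum_divide_distrib)
    also have "\<dots> = (if k = a then 1 else 0)"
    proof (cases "k = a")
      case True
      have "(\<Prod>r<L. of_nat (a + Suc r) - of_nat a) = (fact L :: complex)"
        by (simp add: fact_prod_Suc atLeast0LessThan)
      with True show ?thesis by simp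
    next
      case False
      then have "k - Suc a < L" "of_nat (a + Suc (k - Suc a)) - of_nat k = (0 :: complex)"
        using k by (auto simp flip: of_nat_add)
      then have "(\<Prod>r<L. of_nat (a + Suc r) - of_nat k) = (0::complex)"
        by (intro prod_zero) auto
      with False show ?thesis by simp
    qed
    finally show ?thesis .
  qed
  then show ?thesis by (intro exI[of _ "\<lambda>e. coef e / fact L"]) blast
qed

text \<open>
  The coefficient of a monomial in \<open>x, y, x\<^sub>1, ..., x\<^sub>n\<close>, when \<open>f\<close> is read as a polynomial in these
  variables over \<open>\<complex>[y\<^sub>1, ..., y\<^sub>n]\<close>.
\<close>

definition y_part :: "'n::{finite,linorder} cpoly \<Rightarrow> ('n var \<Rightarrow>\<^sub>0 nat) \<Rightarrow> 'n cpoly" where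
  "y_part f t = (\<Sum>s | s \<in> Poly_Mapping.keys f \<and>
      (\<forall>v. v \<notin> range Vyi \<longrightarrow> Poly_Mapping.lookup s v = Poly_Mapping.lookup t v).
    Poly_Mapping.single (restr (range Vyi) s) (Poly_Mapping.lookup f s))"

text \<open>
  The trailing monomial of \<open>f\<close> is one of those collected in the coefficient, and these are ordered by
  their \<open>y\<close>-parts, so no smaller monomial can occur.
\<close>

lemma trailing_exp_y_part:
  assumes "f \<noteq> 0"
  shows "trailing_exp (y_part f (trailing_exp f)) = restr (range Vyi) (trailing_exp f)"
    and "y_part f (trailing_exp f) \<noteq> 0"
proof -
  define t where "t = trailing_exp f"
  have t: "t \<in> Poly_Mapping.keys f" using trailing_exp_in_keys[OF assms] by (simp add: t_def)
  define B where "B = {s \<in> Poly_Mapping.keys f. \<forall>v. v \<notin> range Vyi \<longrightarrow> Poly_Mapping.lookup s v = Poly_Mapping.lookup t v}"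
  have B: "finite B" "t \<in> B" using t by (auto simp: B_def)
  have "s = t" if "s \<in> B" "restr (range Vyi) s = restr (range Vyi) t" for s
  proof (rule poly_mapping_eqI)
    fix v
    have "Poly_Mapping.lookup (restr (range Vyi) s) v = Poly_Mapping.lookup (restr (range Vyi) t) v"
      by (simp only: that(2))
    then show "Poly_Mapping.lookup s v = Poly_Mapping.lookup t v"
      using that(1) by (cases "v \<in> range Vyi") (auto simp: B_def lookup_restr)
  qed
  then have "Poly_Mapping.lookup (y_part f t) (restr (range Vyi) t) =
      (\<Sum>s\<in>B. if s = t then Poly_Mapping.lookup f s else 0)"
    unfolding y_part_def B_def[symmetric] lookup_sum lookup_single
    by (intro sum.cong refl) (auto simp: when_def)
  also have "\<dots> = Poly_Mapping.lookup f t" using B by simp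
  finally have key: "restr (range Vyi) t \<in> Poly_Mapping.keys (y_part f t)"
    using t by (simp add: in_keys_iff)
  then show "y_part f (trailing_exp f) \<noteq> 0" by (auto simp: t_def)
  show "trailing_exp (y_part f (trailing_exp f)) = restr (range Vyi) (trailing_exp f)"
    unfolding t_def[symmetric]
  proof (rule trailing_exp_eqI[OF key])
    fix u assume "u \<in> Poly_Mapping.keys (y_part f t)"
    then have "Poly_Mapping.lookup (y_part f t) u \<noteq> 0" by (simp add: in_keys_iff)
    then obtain s where s: "s \<in> B" "u = restr (range Vyi) s"
      unfolding y_part_def B_def[symmetric] lookup_sum lookup_single
      by (elim sum.not_neutral_contains_not_neutral) (auto simp: when_def split: if_splits)
    show "restr (range Vyi) t \<le> u"
    proof (rule ccontr)
      assume "\<not> restr (range Vyi) t \<le> u"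
      then have "restr (range Vyi) s < restr (range Vyi) t" using s by simp
      then obtain v where v: "Poly_Mapping.lookup (restr (range Vyi) s) v < Poly_Mapping.lookup (restr (range Vyi) t) v"
        and before: "\<And>w. w < v \<Longrightarrow> Poly_Mapping.lookup (restr (range Vyi) s) w = Poly_Mapping.lookup (restr (range Vyi) t) w"
        using less_poly_mappingE by blast
      have "s < t"
      proof (rule less_poly_mappingI)
        show "Poly_Mapping.lookup s v < Poly_Mapping.lookup t v"
          using v by (auto simp: lookup_restr split: if_splits)
        show "Poly_Mapping.lookup s w = Poly_Mapping.lookup t w" if "w < v" for w
          using before[OF that] s by (cases "w \<in> range Vyi") (auto simp: lookup_restr B_def)
      qed
      moreover have "t \<le> s" using s by (auto simp: t_def B_def intro: trailing_exp_le)
      ultimately show False by simp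
    qed
  qed
qed

text \<open>
  The image of a monomial under the substitution of \<open>x\<^sub>i + x\<^sub>j\<close> for \<open>x\<^sub>i\<close>. This linear change of
  coordinates takes \<open>x\<^sub>i - x\<^sub>j\<close> to the variable \<open>x\<^sub>i\<close>. The \<open>y\<close>-variables are moved into the
  coefficients, so that divisibility by a power of \<open>y\<^sub>i - y\<^sub>j\<close> can be tested coefficient by coefficient.
\<close>

definition shear :: "'n::finite \<Rightarrow> 'n \<Rightarrow> ('n var \<Rightarrow>\<^sub>0 nat) \<Rightarrow> ('n var \<Rightarrow>\<^sub>0 nat) \<Rightarrow>\<^sub>0 'n cpoly" where
  "shear i j s =
    (Poly_Mapping.single (Poly_Mapping.single (Vxi i) 1) 1 +
      Poly_Mapping.single (Poly_Mapping.single (Vxi j) 1) 1) ^ Poly_Mapping.lookup s (Vxi i) *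
    Poly_Mapping.single (restr (- insert (Vxi i) (range Vyi)) s) (Poly_Mapping.single (restr (range Vyi) s) 1)"

lemma monomial_hom_shear:
  "monomial_hom (\<lambda>c::complex. Poly_Mapping.single (0::'n var \<Rightarrow>\<^sub>0 nat)
      (Poly_Mapping.single (0::'n var \<Rightarrow>\<^sub>0 nat) c)) (shear i (j :: 'n::finite))"
proof
  show "shear i j (s + t) = shear i j s * shear i j t" for s t
  proof -
    have "Poly_Mapping.single (restr A (s + t)) (Poly_Mapping.single (restr B (s + t)) (1::complex)) =
       Poly_Mapping.single (restr A s) (Poly_Mapping.single (restr B s) 1) *
       Poly_Mapping.single (restr A t) (Poly_Mapping.single (restr B t) 1)" for A B
      by (simp add: restr_add mult_single)
    then show ?thesis unfolding shear_def lookup_add power_add by (simp only: mult_ac)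
  qed
qed (simp_all add: single_add mult_single shear_def restr_zero)

lemma single_power: "Poly_Mapping.single (Poly_Mapping.single v 1) (1::'c::comm_semiring_1) ^ k =
    Poly_Mapping.single (Poly_Mapping.single v k) 1"
  for v :: 'v
  by (induction k) (simp_all add: mult_single flip: single_add)

lemma shear_eq_sum:
  "shear i j s = (\<Sum>k\<le>Poly_Mapping.lookup s (Vxi i).
    Poly_Mapping.single (Poly_Mapping.single (Vxi i) k +
        Poly_Mapping.single (Vxi j) (Poly_Mapping.lookup s (Vxi i) - k) +
        restr (- insert (Vxi i) (range Vyi)) s)
      (of_nat (Poly_Mapping.lookup s (Vxi i) choose k) * Poly_Mapping.single (restr (range Vyi) s) 1))"
  unfolding shear_def binomial_ring sum_distrib_right single_power
  by (simp add: mult_single mult.assoc add.assoc flip: single_of_nat)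

text \<open>
  Reading off this coefficient selects the monomials of degree \<open>N\<close> in \<open>x\<^sub>i, x\<^sub>j\<close> that agree with
  \<open>t\<close> in the other \<open>x\<close>-variables and in \<open>x, y\<close>.
\<close>

lemma lookup_shear:
  fixes i j :: "'n::finite"
  assumes "i \<noteq> j" "e \<le> N"
  shows "Poly_Mapping.lookup (shear i j s) (Poly_Mapping.single (Vxi i) e +
      Poly_Mapping.single (Vxi j) (N - e) + restr (- ({Vxi i, Vxi j} \<union> range Vyi)) t) =
    (of_nat (Poly_Mapping.lookup s (Vxi i) choose e) * Poly_Mapping.single (restr (range Vyi) s) 1
      when Poly_Mapping.lookup s (Vxi i) + Poly_Mapping.lookup s (Vxi j) = N \<and>
        (\<forall>v. v \<notin> {Vxi i, Vxi j} \<union> range Vyi \<longrightarrow> Poly_Mapping.lookup s v = Poly_Mapping.lookup t v))"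
    (is "_ = (?c e when ?C)")
proof -
  let ?si = "Poly_Mapping.lookup s (Vxi i)"
  have eq: "Poly_Mapping.single (Vxi i) k + Poly_Mapping.single (Vxi j) (?si - k) +
      restr (- insert (Vxi i) (range Vyi)) s =
      Poly_Mapping.single (Vxi i) e + Poly_Mapping.single (Vxi j) (N - e) +
      restr (- ({Vxi i, Vxi j} \<union> range Vyi)) t \<longleftrightarrow> k = e \<and> ?C" (is "?l = ?r \<longleftrightarrow> _")
    if "k \<le> ?si" for k
  proof
    assume eq: "?l = ?r"
    have lk: "Poly_Mapping.lookup ?l v = Poly_Mapping.lookup ?r v" for v by (simp add: eq)
    have "k = e" using lk[of "Vxi i"] assms by (auto simp: lookup_add lookup_single when_def lookup_restr)
    moreover have "?si - k + Poly_Mapping.lookup s (Vxi j) = N - e"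
      using lk[of "Vxi j"] assms by (simp add: lookup_add lookup_single when_def lookup_restr image_iff)
    moreover have "Poly_Mapping.lookup s v = Poly_Mapping.lookup t v"
      if "v \<notin> {Vxi i, Vxi j} \<union> range Vyi" for v
      using lk[of v] that by (auto simp: lookup_add lookup_single when_def lookup_restr)
    ultimately show "k = e \<and> ?C" using that assms by auto
  next
    assume *: "k = e \<and> ?C"
    show "?l = ?r"
    proof (rule poly_mapping_eqI)
      fix v show "Poly_Mapping.lookup ?l v = Poly_Mapping.lookup ?r v"
        using * that assms by (auto simp: lookup_add lookup_single when_def lookup_restr)
    qed
  qed
  have "Poly_Mapping.lookup (shear i j s) (Poly_Mapping.single (Vxi i) e +
      Poly_Mapping.single (Vxi j) (N - e) + restr (- ({Vxi i, Vxi j} \<union> range Vyi)) t) =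
      (\<Sum>k\<le>?si. if k = e then (?c e when ?C) else 0)"
    unfolding shear_eq_sum lookup_sum lookup_single
    by (intro sum.cong refl) (use eq in \<open>auto simp: when_def\<close>)
  also have "\<dots> = (?c e when ?C)"
    by (auto simp: binomial_eq_0)
  finally show ?thesis .
qed

text \<open>
  Let \<open>w = y\<^sub>i - y\<^sub>j\<close>. After the change of coordinates, \<open>f\<close> lies in \<open>(x\<^sub>i, w)\<^sup>P\<close>, so the coefficients
  of monomials with \<open>x\<^sub>i\<close>-exponent \<open>e\<close> are divisible by \<open>w\<^sup>P\<^sup>-\<^sup>e\<close>. Consider the terms of \<open>f\<close> with the
  exponents of \<open>t\<close> in \<open>x\<close>, \<open>y\<close> and all \<open>x\<^sub>l\<close> other than \<open>x\<^sub>i, x\<^sub>j\<close>, and with the same total degree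
  in \<open>x\<^sub>i, x\<^sub>j\<close>. By minimality of \<open>t\<close> and symmetry under exchanging the two points, both of their
  exponents in \<open>x\<^sub>i, x\<^sub>j\<close> are at least \<open>a\<^sub>i\<close>, so the exponent of \<open>x\<^sub>i\<close> is one of the \<open>a\<^sub>j - a\<^sub>i + 1\<close>
  numbers from \<open>a\<^sub>i\<close> to \<open>a\<^sub>j\<close>. The coefficients known to be divisible are combinations of these terms
  with binomial weights, and the ones with \<open>e \<le> a\<^sub>j - a\<^sub>i\<close>, all divisible by the power of \<open>w\<close>
  with exponent \<open>P - (a\<^sub>j - a\<^sub>i)\<close>, suffice to isolate the terms with \<open>x\<^sub>i\<close>-exponent \<open>a\<^sub>i\<close>.
\<close>

lemma difference_power_dvd_y_part:
  fixes f :: "'n::{finite,linorder} cpoly"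
  assumes f: "f \<in> ideal_pow ideal_J P" "f \<noteq> 0"
    and sym: "\<And>\<sigma>. \<sigma> permutes UNIV \<Longrightarrow> perm_poly \<sigma> f = of_int (sgn_char d \<sigma>) * f"
    and ij: "i < j" and t: "t = trailing_exp f"
  shows "(Var (Vyi i) - Var (Vyi j)) ^ (P - (Poly_Mapping.lookup t (Vxi j) - Poly_Mapping.lookup t (Vxi i)))
    dvd y_part f t"
proof -
  interpret monomial_hom "\<lambda>c::complex. Poly_Mapping.single (0::'n var \<Rightarrow>\<^sub>0 nat)
      (Poly_Mapping.single (0::'n var \<Rightarrow>\<^sub>0 nat) c)" "shear i j"
    by (rule monomial_hom_shear)
  define w :: "'n cpoly" where "w = Var (Vyi i) - Var (Vyi j)"
  \<comment> \<open>\<open>V d\<close> is the ideal \<open>(x\<^sub>i, w)\<^sup>d\<close>, described by its coefficients.\<close>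
  define V where "V d = {q :: ('n var \<Rightarrow>\<^sub>0 nat) \<Rightarrow>\<^sub>0 'n cpoly.
    \<forall>T. w ^ (d - Poly_Mapping.lookup T (Vxi i)) dvd Poly_Mapping.lookup q T}" for d
  have V_mult: "p * q \<in> V (d + e)" if "p \<in> V d" "q \<in> V e" for p q d e
    unfolding V_def
  proof safe
    fix T
    have "w ^ (d + e - Poly_Mapping.lookup T (Vxi i)) dvd
        (Poly_Mapping.lookup p S * Poly_Mapping.lookup q S' when S + S' = T)" for S S'
    proof (cases "S + S' = T")
      case True
      have "w ^ (d + e - Poly_Mapping.lookup T (Vxi i)) dvd
          w ^ (d - Poly_Mapping.lookup S (Vxi i)) * w ^ (e - Poly_Mapping.lookup S' (Vxi i))"
        unfolding power_add[symmetric] by (rule le_imp_power_dvd) (use True in \<open>auto simp: lookup_add\<close>)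
      also have "\<dots> dvd Poly_Mapping.lookup p S * Poly_Mapping.lookup q S'"
        using that by (intro mult_dvd_mono) (auto simp: V_def)
      finally show ?thesis using True by (simp add: when_def)
    qed simp
    then show "w ^ (d + e - Poly_Mapping.lookup T (Vxi i)) dvd Poly_Mapping.lookup (p * q) T"
      unfolding lookup_mult_keys by (intro dvd_sum)
  qed
  have V_UNIV: "V 0 = UNIV" by (auto simp: V_def)
  have V_add: "p + q \<in> V d" if "p \<in> V d" "q \<in> V d" for p q d
    using that by (auto simp: V_def lookup_add)
  have lift_x: "lift (Var (Vxi i) - Var (Vxi j)) = Poly_Mapping.single (Poly_Mapping.single (Vxi i) 1) 1"
    using ij by (simp add: lift_diff Var_def lift_single shear_def restr_single lookup_single restr_zero
        mult_single image_iff)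
  have lift_y: "lift (Var (Vyi i) - Var (Vyi j)) = Poly_Mapping.single 0 w"
    using ij by (simp add: lift_diff Var_def lift_single shear_def restr_single lookup_single restr_zero
        mult_single image_iff w_def single_diff)
  have "lift f \<in> V P"
  proof (rule ideal_pow_filtration[OF lift_zero lift_add lift_mult _ V_add V_mult V_UNIV _ f(1)])
    show "0 \<in> V d" for d by (simp add: V_def)
    fix a :: "'n cpoly" assume "a \<in> ideal_J"
    then have "a \<in> ideal_gen {Var (Vxi i) - Var (Vxi j), Var (Vyi i) - Var (Vyi j)}"
      using ij by (auto simp: ideal_J_def)
    then obtain r s where "a = r * (Var (Vxi i) - Var (Vxi j)) + s * (Var (Vyi i) - Var (Vyi j))"
      unfolding ideal_gen_pair_iff by blast
    then have a: "lift a = lift r * Poly_Mapping.single (Poly_Mapping.single (Vxi i) 1) 1 +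
        lift s * Poly_Mapping.single 0 w"
      by (simp add: lift_add lift_mult lift_x lift_y)
    have "Poly_Mapping.single (Poly_Mapping.single (Vxi i) 1) 1 \<in> V 1" "Poly_Mapping.single 0 w \<in> V 1"
      by (auto simp: V_def lookup_single when_def)
    then show "lift a \<in> V 1"
      unfolding a using V_UNIV V_mult[of _ 0 _ 1] by (intro V_add) auto
  qed
  define ti where "ti = Poly_Mapping.lookup t (Vxi i)"
  define tj where "tj = Poly_Mapping.lookup t (Vxi j)"
  have le: "ti \<le> tj" unfolding ti_def tj_def t by (rule trailing_exp_mono[OF sym f(2)]) (use ij in auto)
  define B where "B = {s \<in> Poly_Mapping.keys f. Poly_Mapping.lookup s (Vxi i) + Poly_Mapping.lookup s (Vxi j) = ti + tj \<and>
        (\<forall>v. v \<notin> {Vxi i, Vxi j} \<union> range Vyi \<longrightarrow> Poly_Mapping.lookup s v = Poly_Mapping.lookup t v)}"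
  define m where "m s = Poly_Mapping.single (restr (range Vyi) s) (Poly_Mapping.lookup f s)" for s
  define C where "C e = (\<Sum>s\<in>B. of_nat (Poly_Mapping.lookup s (Vxi i) choose e) * m s)" for e
  have C_dvd: "w ^ (P - e) dvd C e" if "e \<le> ti + tj" for e
  proof -
    let ?T = "Poly_Mapping.single (Vxi i) e + Poly_Mapping.single (Vxi j) (ti + tj - e) +
      restr (- ({Vxi i, Vxi j} \<union> range Vyi)) t"
    have "w ^ (P - Poly_Mapping.lookup ?T (Vxi i)) dvd Poly_Mapping.lookup (lift f) ?T"
      using \<open>lift f \<in> V P\<close> by (simp only: V_def mem_Collect_eq)
    moreover have "Poly_Mapping.lookup ?T (Vxi i) = e"
      using ij by (simp add: lookup_add lookup_single lookup_restr)
    moreover have "Poly_Mapping.lookup (lift f) ?T =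
        (\<Sum>s\<in>Poly_Mapping.keys f. if s \<in> B then of_nat (Poly_Mapping.lookup s (Vxi i) choose e) * m s else 0)"
      unfolding lift_def lookup_sum lookup_single_zero_mult
      by (intro sum.cong refl, subst lookup_shear)
        (use that ij in \<open>auto simp: when_def B_def m_def mult_single mult.left_commute\<close>)
    moreover have "\<dots> = C e"
      unfolding C_def by (subst sum.inter_restrict[symmetric]) (auto simp: B_def intro!: sum.cong)
    ultimately show ?thesis by simp
  qed
  have B_bounds: "ti \<le> Poly_Mapping.lookup s (Vxi i)" "Poly_Mapping.lookup s (Vxi i) \<le> ti + (tj - ti)"
    if "s \<in> B" for s
  proof -
    have s: "s \<in> Poly_Mapping.keys f" "Poly_Mapping.lookup s (Vxi i) + Poly_Mapping.lookup s (Vxi j) = ti + tj"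
      "\<And>v. v \<notin> {Vxi i, Vxi j} \<union> range Vyi \<Longrightarrow> Poly_Mapping.lookup s v = Poly_Mapping.lookup t v"
      using that by (auto simp: B_def)
    have bound: "ti \<le> Poly_Mapping.lookup u (Vxi i)" if u: "u \<in> Poly_Mapping.keys f"
      "\<And>v. v \<notin> {Vxi i, Vxi j} \<union> range Vyi \<Longrightarrow> Poly_Mapping.lookup u v = Poly_Mapping.lookup t v" for u
      unfolding ti_def
    proof (rule poly_mapping_le_lookup)
      show "t \<le> u" using u by (simp add: t trailing_exp_le)
      show "Poly_Mapping.lookup t v = Poly_Mapping.lookup u v" if "v < Vxi i" for v
        using Vxi_before[OF that] ij by (intro u(2)[symmetric]) auto
    qed
    show "ti \<le> Poly_Mapping.lookup s (Vxi i)" using s by (intro bound)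
    define \<tau> where "\<tau> = Transposition.transpose i j"
    have "\<tau> permutes UNIV" by (simp add: \<tau>_def permutes_swap_id)
    then have bij: "bij \<tau>" by (rule permutes_bij)
    have "ti \<le> Poly_Mapping.lookup (Poly_Mapping.map_key (perm_var \<tau>) s) (Vxi i)"
    proof (rule bound)
      show "Poly_Mapping.map_key (perm_var \<tau>) s \<in> Poly_Mapping.keys f"
        using sym[OF \<open>\<tau> permutes UNIV\<close>] bij s(1) by (rule keys_perm_closed)
      fix v assume v: "v \<notin> {Vxi i, Vxi j} \<union> range Vyi"
      then have "perm_var \<tau> v = v" by (cases v) (auto simp: \<tau>_def Transposition.transpose_def)
      then show "Poly_Mapping.lookup (Poly_Mapping.map_key (perm_var \<tau>) s) v = Poly_Mapping.lookup t v"
        using s(3)[OF v] by (simp add: lookup_map_key_perm_var[OF bij])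
    qed
    moreover have "perm_var \<tau> (Vxi i) = Vxi j" by (simp add: \<tau>_def)
    ultimately have "ti \<le> Poly_Mapping.lookup s (Vxi j)"
      by (simp add: lookup_map_key_perm_var[OF bij])
    with s(2) show "Poly_Mapping.lookup s (Vxi i) \<le> ti + (tj - ti)" by linarith
  qed
  obtain coef :: "nat \<Rightarrow> complex" where coef: "\<And>k. ti \<le> k \<Longrightarrow> k \<le> ti + (tj - ti) \<Longrightarrow>
      (\<Sum>e\<le>tj - ti. coef e * of_nat (k choose e)) = (if k = ti then 1 else 0)"
    using interpolate_by_binomials by blast
  have "(\<Sum>e\<le>tj - ti. Poly_Mapping.single 0 (coef e) * C e) =
      (\<Sum>s\<in>B. Poly_Mapping.single 0 (\<Sum>e\<le>tj - ti. coef e * of_nat (Poly_Mapping.lookup s (Vxi i) choose e)) * m s)"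
  proof -
    have single_sum: "Poly_Mapping.single 0 (\<Sum>e\<le>tj - ti. coef e * of_nat (k choose e)) =
        (\<Sum>e\<le>tj - ti. Poly_Mapping.single 0 (coef e) * (of_nat (k choose e) :: 'n cpoly))" for k
      by (rule poly_mapping_eqI) (simp add: lookup_sum lookup_single mult_single when_def flip: single_of_nat)
    show ?thesis
      unfolding C_def sum_distrib_left single_sum sum_distrib_right mult.assoc by (rule sum.swap)
  qed
  also have "\<dots> = (\<Sum>s\<in>B. if Poly_Mapping.lookup s (Vxi i) = ti then m s else 0)"
    by (intro sum.cong refl) (use coef B_bounds in auto)
  also have "\<dots> = y_part f t"
  proof -
    have "{s \<in> B. Poly_Mapping.lookup s (Vxi i) = ti} =
      {s \<in> Poly_Mapping.keys f. \<forall>v. v \<notin> range Vyi \<longrightarrow> Poly_Mapping.lookup s v = Poly_Mapping.lookup t v}"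
      (is "?L = ?R")
    proof (intro set_eqI iffI)
      fix s assume s: "s \<in> ?L"
      then have "Poly_Mapping.lookup s (Vxi j) = Poly_Mapping.lookup t (Vxi j)"
        by (simp add: B_def ti_def tj_def)
      with s have "Poly_Mapping.lookup s v = Poly_Mapping.lookup t v" if "v \<notin> range Vyi" for v
        using that by (cases "v = Vxi i \<or> v = Vxi j") (auto simp: B_def ti_def)
      with s show "s \<in> ?R" by (simp add: B_def)
    next
      fix s assume s: "s \<in> ?R"
      then have "Poly_Mapping.lookup s (Vxi l) = Poly_Mapping.lookup t (Vxi l)" for l
        by (auto simp: image_iff)
      with s show "s \<in> ?L" by (simp add: B_def ti_def tj_def)
    qed
    moreover have "finite B" by (simp add: B_def)
    ultimately show ?thesis
      by (simp add: y_part_def m_def flip: sum.inter_filter)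
  qed
  finally have y: "y_part f t = (\<Sum>e\<le>tj - ti. Poly_Mapping.single 0 (coef e) * C e)" by simp
  have "w ^ (P - (tj - ti)) dvd C e" if "e \<le> tj - ti" for e
    using that le by (intro dvd_trans[OF _ C_dvd] le_imp_power_dvd) auto
  then show ?thesis
    unfolding y w_def[symmetric] ti_def[symmetric] tj_def[symmetric]
    by (intro dvd_sum dvd_mult) auto
qed

section \<open>Order of vanishing at the extra point\<close>

text \<open>
  The image of a monomial under the translation \<open>x\<^sub>j \<mapsto> x\<^sub>j + x\<close>, \<open>y\<^sub>j \<mapsto> y\<^sub>j + y\<close>, which takes the ideal
  \<open>(x\<^sub>j - x, y\<^sub>j - y)\<close> to the monomial ideal \<open>(x\<^sub>j, y\<^sub>j)\<close>.
\<close>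

definition translate :: "'n::finite \<Rightarrow> ('n var \<Rightarrow>\<^sub>0 nat) \<Rightarrow> 'n cpoly" where
  "translate j s =
    (Var (Vxi j) + Var Vx) ^ Poly_Mapping.lookup s (Vxi j) *
    (Var (Vyi j) + Var Vy) ^ Poly_Mapping.lookup s (Vyi j) *
    Poly_Mapping.single (restr (- {Vxi j, Vyi j}) s) 1"

lemma monomial_hom_translate:
  "monomial_hom (\<lambda>c::complex. Poly_Mapping.single (0::'n var \<Rightarrow>\<^sub>0 nat) c) (translate (j :: 'n::finite))"
proof
  show "translate j (s + t) = translate j s * translate j t" for s t
  proof -
    have "Poly_Mapping.single (restr A (s + t)) (1::complex) =
       Poly_Mapping.single (restr A s) 1 * Poly_Mapping.single (restr A t) 1" for A
      by (simp add: restr_add mult_single)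
    then show ?thesis unfolding translate_def lookup_add power_add by (simp only: mult_ac)
  qed
qed (simp_all add: single_add mult_single translate_def restr_zero)

text \<open>
  The translation adds only terms with larger exponents of \<open>x\<close> or \<open>y\<close>, so it does not change the
  terms that are lowest in \<open>x\<close> and \<open>y\<close>.
\<close>

lemma lookup_translate:
  fixes j :: "'n::finite" and s t :: "'n var \<Rightarrow>\<^sub>0 nat"
  assumes x: "Poly_Mapping.lookup t Vx \<le> Poly_Mapping.lookup s Vx"
    and y: "Poly_Mapping.lookup t Vx = Poly_Mapping.lookup s Vx \<Longrightarrow> Poly_Mapping.lookup t Vy \<le> Poly_Mapping.lookup s Vy"
  shows "Poly_Mapping.lookup (translate j s) t = (1 when s = t)"
proof -
  let ?sx = "Poly_Mapping.lookup s (Vxi j)" and ?sy = "Poly_Mapping.lookup s (Vyi j)"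
  define u where "u k l = (Poly_Mapping.single (Vxi j) k + Poly_Mapping.single Vx (?sx - k)) +
    (Poly_Mapping.single (Vyi j) l + Poly_Mapping.single Vy (?sy - l)) + restr (- {Vxi j, Vyi j}) s" for k l
  have "translate j s = (\<Sum>k\<le>?sx. \<Sum>l\<le>?sy.
      Poly_Mapping.single (u k l) (of_nat (?sx choose k) * of_nat (?sy choose l)))"
  proof -
    have collect: "of_nat p * Var v ^ k * Var v' ^ k' * (of_nat q * Var w ^ l * Var w' ^ l') * Poly_Mapping.single r 1 =
        Poly_Mapping.single (Poly_Mapping.single v k + Poly_Mapping.single v' k' +
          (Poly_Mapping.single w l + Poly_Mapping.single w' l') + r) (of_nat p * of_nat q :: complex)"
      for p q k k' l l' :: nat and v v' w w' :: "'n var" and r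
      by (simp only: Var_power single_of_nat[symmetric] mult_single) simp
    show ?thesis
      unfolding translate_def binomial_ring sum_product
      unfolding sum_distrib_right u_def by (simp only: collect)
  qed
  then have "Poly_Mapping.lookup (translate j s) t = (\<Sum>k\<le>?sx. \<Sum>l\<le>?sy.
      (of_nat (?sx choose k) * of_nat (?sy choose l) when u k l = t))"
    by (simp add: lookup_sum lookup_single)
  also have "\<dots> = (\<Sum>k\<le>?sx. \<Sum>l\<le>?sy. if l = ?sy then if k = ?sx then (1 when s = t) else 0 else 0)"
  proof (intro sum.cong refl)
    fix k l assume kl: "k \<in> {..?sx}" "l \<in> {..?sy}"
    have u_top: "u ?sx ?sy = s"
      by (rule poly_mapping_eqI) (simp add: u_def lookup_add lookup_single when_def lookup_restr)
    have top: "k = ?sx \<and> l = ?sy" if "u k l = t"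
    proof -
      have "Poly_Mapping.lookup (u k l) Vx = ?sx - k + Poly_Mapping.lookup s Vx"
        "Poly_Mapping.lookup (u k l) Vy = ?sy - l + Poly_Mapping.lookup s Vy"
        by (simp_all add: u_def lookup_add lookup_single when_def lookup_restr)
      then show ?thesis using x y kl that by auto
    qed
    show "(of_nat (?sx choose k) * of_nat (?sy choose l) when u k l = t) =
        (if l = ?sy then if k = ?sx then ((1::complex) when s = t) else 0 else 0)"
    proof (cases "u k l = t")
      case True
      with top u_top have "k = ?sx" "l = ?sy" "s = t" by metis+
      then show ?thesis using u_top by simp
    next
      case False
      with u_top have "\<not> (k = ?sx \<and> l = ?sy \<and> s = t)" by metis
      with False show ?thesis by auto
    qed
  qed
  also have "\<dots> = (1 when s = t)" by simp
  finally show ?thesis .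
qed

text \<open>
  The terms of \<open>f\<close> that are lowest in \<open>x, y\<close> survive the translation unchanged, and the translated
  polynomial lies in \<open>(x\<^sub>j, y\<^sub>j)\<^sup>K\<close>, a condition on each monomial.
\<close>

lemma order_at_extra_point:
  fixes f :: "'n::{finite,linorder} cpoly"
  assumes f: "f \<in> ideal_pow ideal_I K" and t: "t = trailing_exp f"
    and s: "s \<in> Poly_Mapping.keys f" "Poly_Mapping.lookup s Vx = Poly_Mapping.lookup t Vx"
      "Poly_Mapping.lookup s Vy = Poly_Mapping.lookup t Vy"
  shows "K \<le> Poly_Mapping.lookup s (Vxi j) + Poly_Mapping.lookup s (Vyi j)"
proof -
  interpret monomial_hom "\<lambda>c::complex. Poly_Mapping.single (0::'n var \<Rightarrow>\<^sub>0 nat) c" "translate j"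
    by (rule monomial_hom_translate)
  define V where "V d = {q :: 'n cpoly.
    \<forall>s\<in>Poly_Mapping.keys q. d \<le> Poly_Mapping.lookup s (Vxi j) + Poly_Mapping.lookup s (Vyi j)}" for d
  have V_mult: "p * q \<in> V (d + e)" if "p \<in> V d" "q \<in> V e" for p q d e
    unfolding V_def
  proof safe
    fix s assume "s \<in> Poly_Mapping.keys (p * q)"
    then obtain s1 s2 where "s = s1 + s2" "s1 \<in> Poly_Mapping.keys p" "s2 \<in> Poly_Mapping.keys q"
      using keys_mult[of p q] by blast
    with that show "d + e \<le> Poly_Mapping.lookup s (Vxi j) + Poly_Mapping.lookup s (Vyi j)"
      by (fastforce simp: V_def lookup_add)
  qed
  have V_UNIV: "V 0 = UNIV" by (auto simp: V_def)
  have V_add: "p + q \<in> V d" if "p \<in> V d" "q \<in> V d" for p q d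
    using that Poly_Mapping.keys_add[of p q] by (auto simp: V_def)
  have lift_x: "lift (Var (Vxi j) - Var Vx) = Var (Vxi j)"
    by (simp add: lift_diff Var_def lift_single translate_def restr_single lookup_single restr_zero mult_single)
  have lift_y: "lift (Var (Vyi j) - Var Vy) = Var (Vyi j)"
    by (simp add: lift_diff Var_def lift_single translate_def restr_single lookup_single restr_zero mult_single)
  have "lift f \<in> V K"
  proof (rule ideal_pow_filtration[OF lift_zero lift_add lift_mult _ V_add V_mult V_UNIV _ f])
    show "0 \<in> V d" for d by (simp add: V_def)
    fix a :: "'n cpoly" assume "a \<in> ideal_I"
    then have "a \<in> ideal_gen {Var (Vxi j) - Var Vx, Var (Vyi j) - Var Vy}"
      by (auto simp: ideal_I_def)
    then obtain r s where "a = r * (Var (Vxi j) - Var Vx) + s * (Var (Vyi j) - Var Vy)"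
      unfolding ideal_gen_pair_iff by blast
    then have a: "lift a = lift r * Var (Vxi j) + lift s * Var (Vyi j)"
      by (simp add: lift_add lift_mult lift_x lift_y)
    have "Var (Vxi j) \<in> V 1" "Var (Vyi j) \<in> V 1"
      by (auto simp: V_def Var_def)
    then show "lift a \<in> V 1"
      unfolding a using V_UNIV V_mult[of _ 0 _ 1] by (intro V_add) auto
  qed
  moreover have "Poly_Mapping.lookup (lift f) s = Poly_Mapping.lookup f s"
  proof -
    have "Poly_Mapping.lookup (lift f) s =
        (\<Sum>r\<in>Poly_Mapping.keys f. if r = s then Poly_Mapping.lookup f r else 0)"
      unfolding lift_def lookup_sum lookup_single_zero_mult
    proof (intro sum.cong refl)
      fix r assume "r \<in> Poly_Mapping.keys f"
      then have "t \<le> r" by (simp add: t trailing_exp_le)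
      then have "Poly_Mapping.lookup t Vx \<le> Poly_Mapping.lookup r Vx"
        by (rule poly_mapping_le_lookup) (simp add: less_var_def)
      moreover have "Poly_Mapping.lookup t Vy \<le> Poly_Mapping.lookup r Vy"
        if "Poly_Mapping.lookup t Vx = Poly_Mapping.lookup r Vx"
        using \<open>t \<le> r\<close>
      proof (rule poly_mapping_le_lookup)
        fix w :: "'n var" assume "w < Vy"
        then have "w = Vx" by (cases w) (auto simp: less_var_def)
        then show "Poly_Mapping.lookup t w = Poly_Mapping.lookup r w" using that by simp
      qed
      ultimately have "Poly_Mapping.lookup (translate j r) s = (1 when r = s)"
        using s(2,3) by (intro lookup_translate) simp_all
      then show "Poly_Mapping.lookup f r * Poly_Mapping.lookup (translate j r) s =
          (if r = s then Poly_Mapping.lookup f r else 0)"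
        by (simp add: when_def)
    qed
    also have "\<dots> = Poly_Mapping.lookup f s" using s(1) by simp
    finally show ?thesis .
  qed
  ultimately show ?thesis using s(1) by (auto simp: V_def in_keys_iff)
qed

lemma variable_power_dvd_y_part:
  fixes f :: "'n::{finite,linorder} cpoly"
  assumes f: "f \<in> ideal_pow ideal_I K" and t: "t = trailing_exp f"
  shows "Var (Vyi j) ^ (K - Poly_Mapping.lookup t (Vxi j)) dvd y_part f t"
  unfolding y_part_def
proof (rule dvd_sum)
  fix s assume "s \<in> {s \<in> Poly_Mapping.keys f. \<forall>v. v \<notin> range Vyi \<longrightarrow> Poly_Mapping.lookup s v = Poly_Mapping.lookup t v}"
  then have s: "s \<in> Poly_Mapping.keys f"
    "\<And>v. v \<notin> range Vyi \<Longrightarrow> Poly_Mapping.lookup s v = Poly_Mapping.lookup t v" by auto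
  define k where "k = K - Poly_Mapping.lookup t (Vxi j)"
  define r where "r = restr (range Vyi) s - Poly_Mapping.single (Vyi j) k"
  have "K \<le> Poly_Mapping.lookup s (Vxi j) + Poly_Mapping.lookup s (Vyi j)"
    using f t s(1) by (rule order_at_extra_point) (use s(2) in auto)
  moreover have "Poly_Mapping.lookup s (Vxi j) = Poly_Mapping.lookup t (Vxi j)" using s(2) by auto
  ultimately have "k \<le> Poly_Mapping.lookup s (Vyi j)" by (simp add: k_def)
  then have "restr (range Vyi) s = Poly_Mapping.single (Vyi j) k + r"
    by (intro poly_mapping_eqI) (auto simp: r_def lookup_add lookup_minus lookup_single lookup_restr when_def)
  then have "Poly_Mapping.single (restr (range Vyi) s) (Poly_Mapping.lookup f s) =
      Var (Vyi j) ^ k * Poly_Mapping.single r (Poly_Mapping.lookup f s)"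
    by (simp add: Var_power mult_single)
  then show "Var (Vyi j) ^ (K - Poly_Mapping.lookup t (Vxi j)) dvd
      Poly_Mapping.single (restr (range Vyi) s) (Poly_Mapping.lookup f s)"
    by (simp add: k_def)
qed

section \<open>Combining the divisibility conditions\<close>

text \<open>
  The image of a monomial under the substitution of the variable \<open>w\<close> for \<open>v\<close>.
\<close>

definition identify :: "'n::finite var \<Rightarrow> 'n var \<Rightarrow> ('n var \<Rightarrow>\<^sub>0 nat) \<Rightarrow> 'n cpoly" where
  "identify v w s = Var w ^ Poly_Mapping.lookup s v * Poly_Mapping.single (restr (- {v}) s) 1"

lemma monomial_hom_identify:
  "monomial_hom (\<lambda>c::complex. Poly_Mapping.single (0::'n var \<Rightarrow>\<^sub>0 nat) c) (identify v (w :: 'n::finite var))"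
proof
  show "identify v w (s + t) = identify v w s * identify v w t" for s t
  proof -
    have "Poly_Mapping.single (restr A (s + t)) (1::complex) =
       Poly_Mapping.single (restr A s) 1 * Poly_Mapping.single (restr A t) 1" for A
      by (simp add: restr_add mult_single)
    then show ?thesis unfolding identify_def lookup_add power_add by (simp only: mult_ac)
  qed
qed (simp_all add: single_add mult_single identify_def restr_zero)

definition identify_hom :: "'n::finite var \<Rightarrow> 'n var \<Rightarrow> 'n cpoly \<Rightarrow> 'n cpoly" where
  "identify_hom v w = monomial_hom.lift (\<lambda>c::complex. Poly_Mapping.single (0::'n var \<Rightarrow>\<^sub>0 nat) c) (identify v w)"

lemma identify_hom_mult: "identify_hom v w (f * g) = identify_hom v w f * identify_hom v w g"
  unfolding identify_hom_def by (rule monomial_hom.lift_mult[OF monomial_hom_identify])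

lemma identify_hom_diff: "identify_hom v w (f - g) = identify_hom v w f - identify_hom v w g"
  unfolding identify_hom_def by (rule monomial_hom.lift_diff[OF monomial_hom_identify])

lemma identify_hom_one: "identify_hom v w 1 = 1"
  unfolding identify_hom_def by (rule monomial_hom.lift_one[OF monomial_hom_identify])

lemma identify_hom_Var: "identify_hom v w (Var u) = Var (if u = v then w else u)"
  unfolding identify_hom_def Var_def monomial_hom.lift_single[OF monomial_hom_identify]
  by (simp add: identify_def restr_single lookup_single Var_def)

lemma identify_hom_power: "identify_hom v w (f ^ k) = identify_hom v w f ^ k"
  by (induction k) (simp_all add: identify_hom_one identify_hom_mult)

lemma identify_hom_prod: "identify_hom v w (prod F A) = (\<Prod>i\<in>A. identify_hom v w (F i))"
  by (induction A rule: infinite_finite_induct) (simp_all add: identify_hom_one identify_hom_mult)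

text \<open>
  Substituting \<open>w\<close> for \<open>v\<close> is the reduction modulo \<open>v - w\<close>. As its values lie in an integral domain,
  \<open>v - w\<close> is prime.
\<close>

lemma difference_dvd_iff: "Var v - Var w dvd f \<longleftrightarrow> identify_hom v w f = 0"
  for f :: "'n::finite cpoly"
proof
  assume "Var v - Var w dvd f"
  then show "identify_hom v w f = 0"
    by (auto simp: identify_hom_mult identify_hom_diff identify_hom_Var elim!: dvdE)
next
  assume "identify_hom v w f = 0"
  have "f - identify_hom v w f = (\<Sum>s\<in>Poly_Mapping.keys f.
      Poly_Mapping.single (restr (- {v}) s) (Poly_Mapping.lookup f s) *
      (Var v ^ Poly_Mapping.lookup s v - Var w ^ Poly_Mapping.lookup s v))"
  proof -
    have split_off: "Poly_Mapping.single s c = Poly_Mapping.single (restr (- {v}) s) c * Var v ^ Poly_Mapping.lookup s v"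
      for s and c :: complex
    proof -
      have "s = restr (- {v}) s + Poly_Mapping.single v (Poly_Mapping.lookup s v)"
        by (rule poly_mapping_eqI) (simp add: lookup_add lookup_restr lookup_single when_def)
      then have "Poly_Mapping.single s c =
          Poly_Mapping.single (restr (- {v}) s + Poly_Mapping.single v (Poly_Mapping.lookup s v)) (c * 1)"
        by simp
      then show ?thesis by (simp only: Var_power mult_single)
    qed
    have f_eq: "f = (\<Sum>s\<in>Poly_Mapping.keys f.
        Poly_Mapping.single (restr (- {v}) s) (Poly_Mapping.lookup f s) * Var v ^ Poly_Mapping.lookup s v)"
      unfolding split_off[symmetric] by (rule poly_mapping_sum_single)
    have id_eq: "identify_hom v w f = (\<Sum>s\<in>Poly_Mapping.keys f.
        Poly_Mapping.single (restr (- {v}) s) (Poly_Mapping.lookup f s) * Var w ^ Poly_Mapping.lookup s v)"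
      unfolding identify_hom_def monomial_hom.lift_def[OF monomial_hom_identify] identify_def
      by (intro sum.cong refl) (simp add: mult.left_commute[of "Poly_Mapping.single 0 _"] mult_single mult.commute)
    show ?thesis
      unfolding id_eq by (subst (1) f_eq) (simp only: right_diff_distrib sum_subtractf)
  qed
  also have "Var v - Var w dvd \<dots>"
    by (intro dvd_sum dvd_mult) (metis dvd_triv_left power_diff_sumr2)
  finally show "Var v - Var w dvd f"
    using \<open>identify_hom v w f = 0\<close> by simp
qed

lemma Var_neq_zero: "Var v \<noteq> 0"
  unfolding Var_def by (metis lookup_single_eq lookup_zero one_neq_zero)

lemma Var_eq_iff: "Var v = Var w \<longleftrightarrow> v = w"
proof
  assume "Var v = Var w"
  then have "Poly_Mapping.lookup (Var v) (Poly_Mapping.single v 1) =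
      Poly_Mapping.lookup (Var w) (Poly_Mapping.single v 1)" by simp
  then have "Poly_Mapping.single w (1::nat) = Poly_Mapping.single v 1"
    by (simp add: Var_def lookup_single when_def split: if_splits)
  then have "Poly_Mapping.keys (Poly_Mapping.single w (1::nat)) = Poly_Mapping.keys (Poly_Mapping.single v (1::nat))"
    by simp
  then show "v = w" by simp
qed simp

lemma difference_power_dvd_cancel:
  fixes a b :: "'n::{finite,linorder} cpoly"
  assumes "v \<noteq> w" "\<not> Var v - Var w dvd a" "(Var v - Var w) ^ k dvd a * b"
  shows "(Var v - Var w) ^ k dvd b"
  using assms(3)
proof (induction k arbitrary: b)
  case (Suc k)
  let ?d = "Var v - Var w :: 'n cpoly"
  have d: "?d \<noteq> 0" using assms(1) by (simp add: Var_eq_iff)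
  have "?d dvd a * b" using Suc.prems by (auto elim: dvd_mult_left)
  then have "?d dvd b"
    using assms(2) by (simp add: difference_dvd_iff identify_hom_mult)
  then obtain b' where b: "b = ?d * b'" by (rule dvdE)
  have "?d * ?d ^ k dvd ?d * (a * b')" using Suc.prems by (simp add: b mult.left_commute)
  then have "?d ^ k dvd a * b'" using d by simp
  then have "?d ^ k dvd b'" by (rule Suc.IH)
  then show ?case by (simp add: b mult_dvd_mono)
qed simp

text \<open>
  Substituting \<open>w\<close> for \<open>u\<close> annihilates neither \<open>w\<close> nor \<open>v - w\<close> for \<open>v\<close> other than \<open>u\<close>, so the prime
  \<open>u - w\<close> does not divide the product of the other factors.
\<close>

lemma prod_differences_dvd:
  fixes h :: "'n::{finite,linorder} cpoly"
  assumes "finite S" "w \<notin> S" "Var w ^ k dvd h" "\<And>v. v \<in> S \<Longrightarrow> (Var v - Var w) ^ c v dvd h"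
  shows "Var w ^ k * (\<Prod>v\<in>S. (Var v - Var w) ^ c v) dvd h"
  using assms
proof (induction S rule: finite_induct)
  case (insert u S)
  let ?a = "Var w ^ k * (\<Prod>v\<in>S. (Var v - Var w) ^ c v)"
  have "?a dvd h" using insert by auto
  then obtain b where h: "h = ?a * b" by (rule dvdE)
  have "u \<noteq> w" using insert.prems(1) by auto
  moreover have "\<not> Var u - Var w dvd ?a"
    unfolding difference_dvd_iff
    using insert.hyps insert.prems(1)
    by (auto simp: identify_hom_mult identify_hom_prod identify_hom_power identify_hom_diff
        identify_hom_Var Var_neq_zero Var_eq_iff)
  moreover have "(Var u - Var w) ^ c u dvd ?a * b"
    using insert.prems(3)[of u] unfolding h[symmetric] by simp
  ultimately have "(Var u - Var w) ^ c u dvd b"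
    by (rule difference_power_dvd_cancel)
  then have "?a * (Var u - Var w) ^ c u dvd ?a * b" by (rule mult_dvd_mono[OF dvd_refl])
  moreover have "Var w ^ k * (\<Prod>v\<in>insert u S. (Var v - Var w) ^ c v) = ?a * (Var u - Var w) ^ c u"
  proof -
    have "x * (y * z) = x * z * y" for x y z :: "'n cpoly" by (simp only: mult_ac)
    then show ?thesis unfolding prod.insert[OF insert.hyps] .
  qed
  ultimately show ?case by (simp only: h)
qed simp

lemma trailing_exp_difference:
  fixes v w :: "'n::{finite,linorder} var"
  assumes "v < w"
  shows "trailing_exp (Var v - Var w) = Poly_Mapping.single w 1"
proof (rule trailing_exp_eqI)
  have "Poly_Mapping.single w (1::nat) < Poly_Mapping.single v 1"
    by (rule less_poly_mappingI[of _ v]) (use assms in \<open>auto simp: lookup_single when_def\<close>)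
  then have ne: "Poly_Mapping.single v (1::nat) \<noteq> Poly_Mapping.single w 1" by auto
  then show "Poly_Mapping.single w 1 \<in> Poly_Mapping.keys (Var v - Var w :: 'n cpoly)"
    by (simp add: in_keys_iff lookup_minus Var_def lookup_single when_def)
  fix s assume "s \<in> Poly_Mapping.keys (Var v - Var w :: 'n cpoly)"
  then have "s = Poly_Mapping.single v 1 \<or> s = Poly_Mapping.single w 1"
    by (auto simp: in_keys_iff lookup_minus Var_def lookup_single when_def split: if_splits)
  then show "Poly_Mapping.single w 1 \<le> s"
    using \<open>Poly_Mapping.single w (1::nat) < Poly_Mapping.single v 1\<close> by auto
qed

text \<open>
  The \<open>y\<close>-part at the trailing exponent is divisible by the product of the powers of \<open>y\<^sub>j\<close> and of
  \<open>y\<^sub>i - y\<^sub>j\<close> for \<open>i < j\<close>. Each of these factors has a power of \<open>y\<^sub>j\<close> as its trailing monomial, because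
  the larger variable has the smaller monomial.
\<close>

lemma trailing_exp_section_bound:
  fixes f :: "'n::{finite,linorder} cpoly"
  assumes f: "f \<in> nested_hilb_sections M K" "f \<noteq> 0" and t: "t = trailing_exp f"
  shows "K - Poly_Mapping.lookup t (Vxi j) +
      (\<Sum>i<j. M + K - (Poly_Mapping.lookup t (Vxi j) - Poly_Mapping.lookup t (Vxi i)))
    \<le> Poly_Mapping.lookup t (Vyi j)"
proof -
  define k where "k = K - Poly_Mapping.lookup t (Vxi j)"
  define c where "c v = (case v of Vyi i \<Rightarrow> M + K - (Poly_Mapping.lookup t (Vxi j) - Poly_Mapping.lookup t (Vxi i)) | _ \<Rightarrow> 0)" for v
  define h where "h = y_part f t"
  let ?w = "Vyi j" and ?S = "Vyi ` {..<j}"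
  let ?p = "\<lambda>v. (Var v - Var ?w) ^ c v :: 'n cpoly"
  have J: "f \<in> ideal_pow ideal_J (M + K)" and I: "f \<in> ideal_pow ideal_I K"
    and sym: "\<And>\<sigma>. \<sigma> permutes UNIV \<Longrightarrow> perm_poly \<sigma> f = of_int (sgn_char (M + K) \<sigma>) * f"
    using f by (auto simp: nested_hilb_sections_def)
  have "Var ?w ^ k * (\<Prod>v\<in>?S. ?p v) dvd h"
    unfolding h_def k_def
  proof (rule prod_differences_dvd)
    show "Var ?w ^ (K - Poly_Mapping.lookup t (Vxi j)) dvd y_part f t"
      using I t by (rule variable_power_dvd_y_part)
    fix v assume "v \<in> ?S"
    then obtain i where i: "v = Vyi i" "i < j" by auto
    show "?p v dvd y_part f t"
      using difference_power_dvd_y_part[OF J f(2) sym i(2) t] by (simp add: i c_def)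
  qed auto
  then obtain q where q: "h = Var ?w ^ k * (\<Prod>v\<in>?S. ?p v) * q" by (rule dvdE)
  have h: "h \<noteq> 0" "trailing_exp h = restr (range Vyi) t"
    unfolding h_def t using f(2) by (rule trailing_exp_y_part)+
  have p: "?p v \<noteq> 0" if "v \<in> ?S" for v using that by (auto simp: Var_eq_iff)
  have "Poly_Mapping.lookup t ?w = Poly_Mapping.lookup (trailing_exp h) ?w"
    by (simp add: h lookup_restr)
  also have "\<dots> = Poly_Mapping.lookup (trailing_exp (Var ?w ^ k)) ?w +
      (\<Sum>v\<in>?S. Poly_Mapping.lookup (trailing_exp (?p v)) ?w) + Poly_Mapping.lookup (trailing_exp q) ?w"
  proof -
    have "Var ?w ^ k \<noteq> (0 :: 'n cpoly)" by (simp add: Var_neq_zero)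
    moreover have "(\<Prod>v\<in>?S. ?p v) \<noteq> 0" using p by simp
    moreover have "q \<noteq> 0" using h q by auto
    ultimately have "trailing_exp h = trailing_exp (Var ?w ^ k) + trailing_exp (\<Prod>v\<in>?S. ?p v) + trailing_exp q"
      unfolding q by (simp only: trailing_exp_mult mult_eq_0_iff simp_thms)
    also have "trailing_exp (\<Prod>v\<in>?S. ?p v) = (\<Sum>v\<in>?S. trailing_exp (?p v))"
      by (rule trailing_exp_prod) (rule p)
    finally show ?thesis by (simp only: lookup_add lookup_sum)
  qed
  also have "Poly_Mapping.lookup (trailing_exp (Var ?w ^ k :: 'n cpoly)) ?w = k"
    by (simp add: Var_power trailing_exp_single)
  also have "(\<Sum>v\<in>?S. Poly_Mapping.lookup (trailing_exp (?p v)) ?w) = (\<Sum>v\<in>?S. c v)"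
  proof (intro sum.cong refl)
    fix v assume "v \<in> ?S"
    then have "v < ?w" by (auto simp: less_var_def)
    then have "Var v - Var ?w \<noteq> (0 :: 'n cpoly)" by (auto simp: Var_eq_iff)
    then show "Poly_Mapping.lookup (trailing_exp (?p v)) ?w = c v"
      using \<open>v < ?w\<close> by (simp add: trailing_exp_power trailing_exp_difference)
  qed
  also have "(\<Sum>v\<in>?S. c v) = (\<Sum>i<j. M + K - (Poly_Mapping.lookup t (Vxi j) - Poly_Mapping.lookup t (Vxi i)))"
    by (subst sum.reindex) (auto simp: c_def inj_on_def)
  finally show ?thesis by (simp add: k_def)
qed

section \<open>Alternants\<close>

text \<open>
  The \<open>n + 1\<close> points are indexed by the option type, whose least element \<open>None\<close> stands for the
  extra point \<open>(x, y)\<close>.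
\<close>

primrec px :: "'n option \<Rightarrow> 'n var" where
  "px None = Vx"
| "px (Some i) = Vxi i"

primrec py :: "'n option \<Rightarrow> 'n var" where
  "py None = Vy"
| "py (Some i) = Vyi i"

lemma px_eq_iff [simp]: "px q = px q' \<longleftrightarrow> q = q'"
  by (cases q; cases q') auto

lemma py_eq_iff [simp]: "py q = py q' \<longleftrightarrow> q = q'"
  by (cases q; cases q') auto

lemma px_neq_py [simp]: "px q \<noteq> py q'" "py q' \<noteq> px q"
  by (cases q; cases q'; simp)+

lemma var_cases_point: obtains q where "v = px q" | q where "v = py q"
  by (cases v) (metis px.simps py.simps)+

lemma px_less_iff: "px q < px q' \<longleftrightarrow> q < q'"
  by (cases q; cases q') (auto simp: less_var_def not_le)

lemma py_less_iff: "py q < py q' \<longleftrightarrow> q < q'"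
  by (cases q; cases q') (auto simp: less_var_def not_le)

lemma px_less_py_Some: "px q < py (Some i)"
  by (cases q) (auto simp: less_var_def)

definition alternant_term ::
    "'n::finite option set \<Rightarrow> ('n option \<Rightarrow> nat) \<Rightarrow> ('n option \<Rightarrow> nat) \<Rightarrow> 'n cpoly" where
  "alternant_term S c e = (\<Prod>q\<in>S. Var (px q) ^ c q * Var (py q) ^ e q)"

text \<open>
  The determinant of the matrix with entries \<open>x\<^sub>q\<^sup>c y\<^sub>q\<^sup>e\<close>, where \<open>q\<close> runs over the points in \<open>S\<close> and
  \<open>(c, e)\<close> over the exponent pairs attached to them.
\<close>

definition alternant ::
    "'n::finite option set \<Rightarrow> ('n option \<Rightarrow> nat) \<Rightarrow> ('n option \<Rightarrow> nat) \<Rightarrow> 'n cpoly" where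
  "alternant S c e = (\<Sum>p | p permutes S. of_int (sign p) * alternant_term S (c \<circ> p) (e \<circ> p))"

definition alternant_exp ::
    "'n::finite option set \<Rightarrow> ('n option \<Rightarrow> nat) \<Rightarrow> ('n option \<Rightarrow> nat) \<Rightarrow> 'n var \<Rightarrow>\<^sub>0 nat" where
  "alternant_exp S c e =
    (\<Sum>q\<in>S. Poly_Mapping.single (px q) (c q) + Poly_Mapping.single (py q) (e q))"

lemma alternant_term_eq: "alternant_term S c e = Poly_Mapping.single (alternant_exp S c e) 1"
  unfolding alternant_term_def alternant_exp_def
  by (simp add: Var_power mult_single prod_single)

lemma lookup_alternant_exp:
  "Poly_Mapping.lookup (alternant_exp S c e) (px q) = (if q \<in> S then c q else 0)"
  "Poly_Mapping.lookup (alternant_exp S c e) (py q) = (if q \<in> S then e q else 0)"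
  by (simp_all add: alternant_exp_def lookup_sum lookup_add lookup_single when_def)

lemma of_int_mult_single:
  "of_int z * Poly_Mapping.single s (1::complex) = Poly_Mapping.single s (of_int z)"
  for s :: "'v \<Rightarrow>\<^sub>0 nat"
  by (simp add: mult_single flip: single_of_int)

lemma lookup_alternant:
  "Poly_Mapping.lookup (alternant S c e) t =
    (\<Sum>p | p permutes S. of_int (sign p) when alternant_exp S (c \<circ> p) (e \<circ> p) = t)"
  unfolding alternant_def alternant_term_eq of_int_mult_single
  by (simp add: lookup_sum lookup_single)

lemma invariant_subset_closed:
  assumes "finite A" "inj r" "r ` A \<subseteq> A" "r q \<in> A"
  shows "q \<in> A"
proof -
  have "r ` A = A"
    using assms by (intro endo_inj_surj) (auto intro: inj_on_subset)
  then show ?thesis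
    using assms by (metis imageE injD)
qed

text \<open>
  The exponent pairs increase lexicographically along the points. The condition at \<open>None\<close> makes up
  for the variable order, in which \<open>y\<close> precedes all \<open>x\<^sub>i\<close>: the extra point then has the smallest
  possible exponent of \<open>y\<close>.
\<close>

definition stepped :: "'n::linorder option set \<Rightarrow> ('n option \<Rightarrow> nat) \<Rightarrow> ('n option \<Rightarrow> nat) \<Rightarrow> bool" where
  "stepped S c e \<longleftrightarrow>
    (\<forall>q\<in>S. \<forall>q'\<in>S. q < q' \<longrightarrow> c q < c q' \<or> c q = c q' \<and> e q < e q') \<and> (None \<in> S \<longrightarrow> e None = 0)"

text \<open>
  Suppose that a rearrangement \<open>r\<close> gives a smaller monomial, and consider the first variable where
  its exponent drops, say at the point \<open>q\<close>. All points that carry the smaller value (together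
  with the same \<open>x\<close>-exponent, if the variable is \<open>y\<^sub>q\<close>) come before \<open>q\<close> and have kept their values, so \<open>r\<close> permutes them; but \<open>r\<close> also maps \<open>q\<close> to one of them.
\<close>

lemma alternant_exp_permuted_ge:
  fixes S :: "'n::{finite,linorder} option set"
  assumes "stepped S c e" and r: "r permutes S"
  shows "alternant_exp S c e \<le> alternant_exp S (c \<circ> r) (e \<circ> r)"
proof (rule ccontr)
  have step: "\<And>q q'. q \<in> S \<Longrightarrow> q' \<in> S \<Longrightarrow> q < q' \<Longrightarrow> c q < c q' \<or> c q = c q' \<and> e q < e q'"
    and None: "None \<in> S \<Longrightarrow> e None = 0"
    using assms by (auto simp: stepped_def)
  have rS: "r q \<in> S \<longleftrightarrow> q \<in> S" for q using r by (rule permutes_in_image)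
  have inj: "inj r" using r by (rule permutes_inj)
  assume "\<not> alternant_exp S c e \<le> alternant_exp S (c \<circ> r) (e \<circ> r)"
  then have "alternant_exp S (c \<circ> r) (e \<circ> r) < alternant_exp S c e" by simp
  then obtain v where v: "Poly_Mapping.lookup (alternant_exp S (c \<circ> r) (e \<circ> r)) v
        < Poly_Mapping.lookup (alternant_exp S c e) v"
    and before: "\<And>w. w < v \<Longrightarrow> Poly_Mapping.lookup (alternant_exp S (c \<circ> r) (e \<circ> r)) w
        = Poly_Mapping.lookup (alternant_exp S c e) w"
    using less_poly_mappingE by blast
  show False
  proof (cases v rule: var_cases_point)
    case (1 q)
    then have q: "q \<in> S" "c (r q) < c q" using v by (auto simp: lookup_alternant_exp split: if_splits)
    define A where "A = {q' \<in> S. c q' = c (r q)}"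
    have "r q' \<in> A" if "q' \<in> A" for q'
    proof -
      have q': "q' \<in> S" "c q' = c (r q)" using that by (auto simp: A_def)
      with q step[of q q'] have "q' < q" by (metis less_asym less_irrefl linorder_neqE)
      with 1 have "px q' < v" by (simp add: px_less_iff)
      from before[OF this] q' show ?thesis by (simp add: A_def lookup_alternant_exp rS)
    qed
    moreover have "r q \<in> A" using q rS by (auto simp: A_def)
    ultimately have "q \<in> A"
      using inj by (intro invariant_subset_closed[of A r q]) auto
    with q show False by (simp add: A_def)
  next
    case (2 q)
    then have q: "q \<in> S" "e (r q) < e q" using v by (auto simp: lookup_alternant_exp split: if_splits)
    then obtain i where i: "q = Some i" using None by (cases q) auto
    have c: "c (r q') = c q'" if "q' \<in> S" for q'
      using before[of "px q'"] that px_less_py_Some[of q' i] by (simp add: 2 i lookup_alternant_exp del: py.simps)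
    define A where "A = {q' \<in> S. c q' = c q \<and> e q' = e (r q)}"
    have "r q' \<in> A" if "q' \<in> A" for q'
    proof -
      have q': "q' \<in> S" "c q' = c q" "e q' = e (r q)" using that by (auto simp: A_def)
      with q step[of q q'] have "q' < q" by (metis less_asym less_irrefl linorder_neqE)
      with 2 have "py q' < v" by (simp add: py_less_iff)
      from before[OF this] q' c show ?thesis by (simp add: A_def lookup_alternant_exp rS)
    qed
    moreover have "r q \<in> A" using q rS c by (auto simp: A_def)
    ultimately have "q \<in> A"
      using inj by (intro invariant_subset_closed[of A r q]) auto
    with q show False by (simp add: A_def)
  qed
qed

lemma alternant_exp_permuted_eq:
  fixes S :: "'n::{finite,linorder} option set"
  assumes "stepped S c e" and p: "p permutes S"
    and eq: "alternant_exp S (c \<circ> p) (e \<circ> p) = alternant_exp S c e"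
  shows "p = id"
proof
  have step: "\<And>q q'. q \<in> S \<Longrightarrow> q' \<in> S \<Longrightarrow> q < q' \<Longrightarrow> c q < c q' \<or> c q = c q' \<and> e q < e q'"
    using assms by (auto simp: stepped_def)
  fix q
  show "p q = id q"
  proof (cases "q \<in> S")
    case True
    then have "c (p q) = c q" "e (p q) = e q" "p q \<in> S"
      using arg_cong[OF eq, of "\<lambda>t. Poly_Mapping.lookup t (px q)"]
        arg_cong[OF eq, of "\<lambda>t. Poly_Mapping.lookup t (py q)"] permutes_in_image[OF p, of q]
      by (auto simp: lookup_alternant_exp)
    with True step[of q "p q"] step[of "p q" q] show ?thesis
      by (metis id_apply less_irrefl linorder_neqE)
  next
    case False
    then show ?thesis using p by (simp add: permutes_not_in)
  qed
qed

lemma trailing_exp_alternant: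
  fixes S :: "'n::{finite,linorder} option set"
  assumes "stepped S c e"
  shows "trailing_exp (alternant S c e) = alternant_exp S c e" "alternant S c e \<noteq> 0"
proof -
  have "Poly_Mapping.lookup (alternant S c e) (alternant_exp S c e) =
      (\<Sum>p | p permutes S. if p = id then 1 else 0)"
    unfolding lookup_alternant
    by (intro sum.cong refl) (use alternant_exp_permuted_eq[OF assms] in \<open>auto simp: when_def sign_id\<close>)
  also have "\<dots> = 1"
    by (subst sum.delta) (auto simp: finite_permutations permutes_id)
  finally have 1: "alternant_exp S c e \<in> Poly_Mapping.keys (alternant S c e)"
    by (simp add: in_keys_iff)
  then show "alternant S c e \<noteq> 0" by auto
  show "trailing_exp (alternant S c e) = alternant_exp S c e"
  proof (rule trailing_exp_eqI[OF 1])
    fix s assume "s \<in> Poly_Mapping.keys (alternant S c e)"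
    then obtain p where "p permutes S" "alternant_exp S (c \<circ> p) (e \<circ> p) = s"
      unfolding in_keys_iff lookup_alternant by (elim sum.not_neutral_contains_not_neutral) auto
    then show "alternant_exp S c e \<le> s"
      using alternant_exp_permuted_ge[OF assms] by blast
  qed
qed

lemma alternant_term_reindex:
  fixes S :: "'n::finite option set"
  assumes "\<tau> permutes S"
  shows "alternant_term S (c \<circ> \<tau>) (e \<circ> \<tau>) = (\<Prod>q\<in>S. Var (px (inv \<tau> q)) ^ c q * Var (py (inv \<tau> q)) ^ e q)"
  unfolding alternant_term_def
  by (subst prod.permute[OF permutes_inv[OF assms]])
    (simp add: permutes_inverses[OF assms] o_def)

lemma alternant_compose:
  fixes S :: "'n::finite option set"
  assumes "\<tau> permutes S"
  shows "(\<Sum>p | p permutes S. of_int (sign p) * alternant_term S (c \<circ> p \<circ> \<tau>) (e \<circ> p \<circ> \<tau>)) =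
    of_int (sign \<tau>) * alternant S c e"
proof -
  have "alternant S c e = (\<Sum>p | p permutes S. of_int (sign (p \<circ> \<tau>)) *
      alternant_term S (c \<circ> (p \<circ> \<tau>)) (e \<circ> (p \<circ> \<tau>)))"
    unfolding alternant_def by (rule sum_permutations_compose_right[OF assms])
  then have "of_int (sign \<tau>) * alternant S c e =
      (\<Sum>p | p permutes S. of_int (sign \<tau>) * of_int (sign (p \<circ> \<tau>)) *
        alternant_term S (c \<circ> (p \<circ> \<tau>)) (e \<circ> (p \<circ> \<tau>)))"
    by (simp only: sum_distrib_left mult.assoc)
  also have "\<dots> = (\<Sum>p | p permutes S. of_int (sign p) * alternant_term S (c \<circ> p \<circ> \<tau>) (e \<circ> p \<circ> \<tau>))"
  proof (intro sum.cong refl)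
    fix p assume "p \<in> {p. p permutes S}"
    then have "sign (p \<circ> \<tau>) = sign p * sign \<tau>"
      using assms by (intro sign_compose permutes_imp_permutation[of S]) auto
    then have "sign \<tau> * sign (p \<circ> \<tau>) = sign p" by (simp add: sign_def)
    then show "of_int (sign \<tau>) * of_int (sign (p \<circ> \<tau>)) * alternant_term S (c \<circ> (p \<circ> \<tau>)) (e \<circ> (p \<circ> \<tau>)) =
        of_int (sign p) * alternant_term S (c \<circ> p \<circ> \<tau>) (e \<circ> p \<circ> \<tau>)"
      by (simp add: o_assoc flip: of_int_mult)
  qed
  finally show ?thesis by simp
qed

lemma ideal_gen_prod_diff:
  assumes "\<And>i. i \<in> A \<Longrightarrow> u i - v i \<in> ideal_gen G"
  shows "(\<Prod>i\<in>A. u i) - (\<Prod>i\<in>A. v i) \<in> ideal_gen G"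
  using assms
proof (induction A rule: infinite_finite_induct)
  case (insert i A)
  have "(\<Prod>i\<in>insert i A. u i) - (\<Prod>i\<in>insert i A. v i) =
      u i * ((\<Prod>i\<in>A. u i) - (\<Prod>i\<in>A. v i)) + (\<Prod>i\<in>A. v i) * (u i - v i)"
    using insert by (simp add: algebra_simps)
  also have "\<dots> \<in> ideal_gen G"
    using insert by (intro ideal_gen_add ideal_gen_mult) auto
  finally show ?case .
qed (simp_all add: ideal_gen_zero)

lemma ideal_gen_power_diff:
  "u - v \<in> ideal_gen G \<Longrightarrow> u ^ k - v ^ k \<in> ideal_gen G"
  using ideal_gen_prod_diff[of "{..<k}" "\<lambda>_. u" "\<lambda>_. v" G] by simp

lemma ideal_gen_mult_diff:
  assumes "u - v \<in> ideal_gen G" "u' - v' \<in> ideal_gen G"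
  shows "u * u' - v * v' \<in> ideal_gen G"
proof -
  have "u * u' - v * v' = u * (u' - v') + v' * (u - v)" by (simp add: algebra_simps)
  then show ?thesis using assms by (simp add: ideal_gen_add ideal_gen_mult)
qed

text \<open>
  Exchanging the points \<open>q1\<close> and \<open>q2\<close> changes the sign of the alternant, but changes each of its
  terms only by an element of the ideal; so twice the alternant lies in the ideal.
\<close>

lemma alternant_in_ideal:
  fixes S :: "'n::finite option set"
  assumes "q1 \<in> S" "q2 \<in> S" "q1 \<noteq> q2"
  shows "alternant S c e \<in> ideal_gen {Var (px q1) - Var (px q2), Var (py q1) - Var (py q2)}"
    (is "_ \<in> ?I")
proof -
  define \<tau> where "\<tau> = Transposition.transpose q1 q2"
  have \<tau>: "\<tau> permutes S" using assms by (simp add: \<tau>_def permutes_swap_id)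
  have sg: "sign \<tau> = -1" using assms by (simp add: \<tau>_def sign_swap_id)
  have base: "Var (px q1) - Var (px q2) \<in> ?I" "Var (py q1) - Var (py q2) \<in> ?I"
    by (auto simp: ideal_gen_def intro: ring_module.span_base)
  then have base': "Var (px q2) - Var (px q1) \<in> ?I" "Var (py q2) - Var (py q1) \<in> ?I"
    using ideal_gen_mult[of _ _ "-1"] by fastforce+
  have swap: "Var (px q) - Var (px (\<tau> q)) \<in> ?I" "Var (py q) - Var (py (\<tau> q)) \<in> ?I" for q
    using base base' by (auto simp: \<tau>_def Transposition.transpose_def ideal_gen_zero)
  have inv: "inv \<tau> = \<tau>" by (simp add: \<tau>_def)
  have swap_term: "alternant_term S c e - alternant_term S (c \<circ> \<tau>) (e \<circ> \<tau>) \<in> ?I" for c e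
    unfolding alternant_term_reindex[OF \<tau>] inv unfolding alternant_term_def
    by (intro ideal_gen_prod_diff ideal_gen_mult_diff ideal_gen_power_diff swap)
  have "2 * alternant S c e = alternant S c e - of_int (sign \<tau>) * alternant S c e"
    by (simp add: sg)
  also have "\<dots> = (\<Sum>p | p permutes S. of_int (sign p) *
      (alternant_term S (c \<circ> p) (e \<circ> p) - alternant_term S (c \<circ> p \<circ> \<tau>) (e \<circ> p \<circ> \<tau>)))"
    unfolding alternant_compose[OF \<tau>, symmetric] unfolding alternant_def
    by (simp add: sum_subtractf right_diff_distrib)
  also have "\<dots> \<in> ?I"
    by (intro ideal_gen_sum ideal_gen_mult swap_term)
  finally have "Poly_Mapping.single 0 (1/2) * (2 * alternant S c e) \<in> ?I"
    by (rule ideal_gen_mult)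
  moreover have "Poly_Mapping.single 0 (1/2) * (2 * alternant S c e) = alternant S c e"
  proof -
    have "Poly_Mapping.single 0 (1/2) * (2 :: 'n cpoly) = 1"
      by (simp add: mult_single flip: single_numeral)
    then show ?thesis by (simp flip: mult.assoc)
  qed
  ultimately show ?thesis by simp
qed

lemma perm_poly_alternant:
  fixes S :: "'n::finite option set"
  assumes \<sigma>: "\<sigma> permutes UNIV" and S: "S = range Some \<or> S = UNIV"
  shows "perm_poly \<sigma> (alternant S c e) = of_int (sign \<sigma>) * alternant S c e"
proof -
  define \<tau> where "\<tau> = map_permutation UNIV Some \<sigma>"
  have "\<tau> permutes range Some"
    unfolding \<tau>_def using \<sigma> by (intro map_permutation_permutes) (auto simp: bij_betw_def)
  then have \<tau>: "\<tau> permutes S" using S by (auto intro: permutes_subset)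
  have sg: "sign \<tau> = sign \<sigma>"
    unfolding \<tau>_def using \<sigma> by (intro sign_map_permutation) auto
  have bij: "bij \<sigma>" using \<sigma> by (rule permutes_bij)
  have "\<tau> (Some i) = Some (\<sigma> i)" for i
    unfolding \<tau>_def by (rule map_permutation_apply) auto
  moreover have "\<tau> None = None"
    using \<open>\<tau> permutes range Some\<close> by (simp add: permutes_not_in)
  ultimately have pv: "perm_var \<sigma> (px q) = px (\<tau> q)" "perm_var \<sigma> (py q) = py (\<tau> q)" for q
    by (cases q; simp)+
  have inv: "inv \<tau> permutes S" "inv (inv \<tau>) = \<tau>"
    using \<tau> by (auto simp: permutes_inv permutes_inv_inv)
  have swap_term: "perm_poly \<sigma> (alternant_term S c e) = alternant_term S (c \<circ> inv \<tau>) (e \<circ> inv \<tau>)" for c e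
    unfolding alternant_term_reindex[OF inv(1)] inv(2)
    by (simp add: alternant_term_def perm_poly_prod perm_poly_mult perm_poly_power perm_poly_Var bij pv)
  have sgn: "perm_poly \<sigma> (of_int (sign p) * f) = of_int (sign p) * perm_poly \<sigma> f" for p :: "'n option \<Rightarrow> 'n option" and f
    by (cases p rule: sign_cases) (simp_all add: perm_poly_uminus bij)
  have "perm_poly \<sigma> (alternant S c e) =
    (\<Sum>p | p permutes S. of_int (sign p) * alternant_term S (c \<circ> p \<circ> inv \<tau>) (e \<circ> p \<circ> inv \<tau>))"
    unfolding alternant_def by (simp add: perm_poly_sum bij sgn swap_term)
  also have "\<dots> = of_int (sign (inv \<tau>)) * alternant S c e"
    by (rule alternant_compose[OF inv(1)])
  also have "sign (inv \<tau>) = sign \<sigma>"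
    using \<tau> sg by (subst sign_inverse) (auto intro: permutes_imp_permutation)
  finally show ?thesis .
qed

section \<open>Sections with prescribed trailing exponents\<close>

text \<open>
  Hermite's identity for floors. Passing from \<open>s\<close> to \<open>s + 1\<close> shifts the summation range by one, which
  replaces \<open>s div P\<close> by \<open>(s + P) div P\<close>.
\<close>

lemma sum_div_shifts:
  fixes P s :: nat
  assumes "0 < P"
  shows "(\<Sum>r<P. (s + r) div P) = s"
proof (induction s)
  case 0
  then show ?case by (simp add: assms)
next
  case (Suc s)
  define g where "g r = (s + r) div P" for r
  have "(\<Sum>r<P. (Suc s + r) div P) + g 0 = (\<Sum>r<P. g (Suc r)) + g 0"
    by (simp add: g_def)
  also have "\<dots> = (\<Sum>r<P. g r) + g P"
    using sum.lessThan_Suc_shift[of g P] by simp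
  also have "(\<Sum>r<P. g r) = s" using Suc by (simp add: g_def)
  also have "g P = g 0 + 1" using assms by (simp add: g_def)
  finally show ?case by simp
qed

text \<open>
  If the quotients agree, adding \<open>y - x\<close> to \<open>x + r\<close> causes no carry, so the remainder of \<open>x + r\<close> is
  less than \<open>P - (y - x)\<close>; and \<open>r < P\<close> is determined by this remainder.
\<close>

lemma card_equal_quotients_le:
  fixes P x y :: nat
  assumes "x \<le> y"
  shows "card {r. r < P \<and> (x + r) div P = (y + r) div P} \<le> P - (y - x)"
proof -
  have "card {r. r < P \<and> (x + r) div P = (y + r) div P} \<le> card {..<P - (y - x)}"
  proof (rule card_inj_on_le[where f = "\<lambda>r. (x + r) mod P"])
    show "inj_on (\<lambda>r. (x + r) mod P) {r. r < P \<and> (x + r) div P = (y + r) div P}"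
    proof (rule linorder_inj_onI')
      fix r r' assume *: "r \<in> {r. r < P \<and> (x + r) div P = (y + r) div P}"
        "r' \<in> {r. r < P \<and> (x + r) div P = (y + r) div P}" "r < r'"
      have "\<not> P dvd (x + r') - (x + r)" using * by (auto dest: dvd_imp_le)
      then show "(x + r) mod P \<noteq> (x + r') mod P"
        using mod_eq_dvd_iff_nat[of "x + r" "x + r'" P] \<open>r < r'\<close> by auto
    qed
    show "(\<lambda>r. (x + r) mod P) ` {r. r < P \<and> (x + r) div P = (y + r) div P} \<subseteq> {..<P - (y - x)}"
    proof safe
      fix r assume r: "r < P" "(x + r) div P = (y + r) div P"
      have "(x + r) mod P + (y - x) = (y + r) mod P"
      proof -
        have "(y + r) div P * P + (x + r) mod P = x + r"
          using r(2) by (metis div_mult_mod_eq)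
        moreover have "(y + r) div P * P + (y + r) mod P = y + r"
          by (rule div_mult_mod_eq)
        ultimately show ?thesis using assms by linarith
      qed
      also have "\<dots> < P" using r(1) by simp
      finally show "(x + r) mod P < P - (y - x)" by simp
    qed
  qed auto
  then show ?thesis by simp
qed

lemma card_zero_quotients_le:
  fixes P M a :: nat
  shows "card {r. r < P \<and> M \<le> r \<and> (a + r) div P = 0} \<le> P - M - a"
proof -
  have "{r. r < P \<and> M \<le> r \<and> (a + r) div P = 0} \<subseteq> {M..<P - a}"
    by (auto simp: div_eq_0_iff)
  then have "card {r. r < P \<and> M \<le> r \<and> (a + r) div P = 0} \<le> card {M..<P - a}"
    by (intro card_mono) auto
  then show ?thesis by simp
qed

text \<open>
  For weakly increasing \<open>x\<close>-exponents \<open>c\<close>, these are the smallest \<open>y\<close>-exponents that make the exponent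
  pairs strictly increasing.
\<close>

definition level :: "'n::linorder option set \<Rightarrow> ('n option \<Rightarrow> nat) \<Rightarrow> 'n option \<Rightarrow> nat" where
  "level S c q = card {q' \<in> S. q' < q \<and> c q' = c q}"

lemma stepped_level:
  fixes S :: "'n::{finite,linorder} option set"
  assumes "\<And>q q'. q \<le> q' \<Longrightarrow> c q \<le> c q'"
  shows "stepped S c (level S c)"
  unfolding stepped_def
proof (intro conjI ballI impI)
  fix q q' assume q: "q \<in> S" "q' \<in> S" "q < q'"
  have "level S c q < level S c q'" if "c q = c q'"
    unfolding level_def by (rule psubset_card_mono) (use q that in auto)
  moreover have "c q \<le> c q'" using q assms by simp
  ultimately show "c q < c q' \<or> c q = c q' \<and> level S c q < level S c q'" by linarith
next
  have "{q' \<in> S. q' < None \<and> c q' = c None} = {}" by auto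
  then show "level S c None = 0" by (simp add: level_def)
qed

lemma alternant_in_ideal_J:
  fixes c e :: "'n::{finite,linorder} option \<Rightarrow> nat"
  assumes "range Some \<subseteq> S"
  shows "alternant S c e \<in> ideal_J"
  unfolding ideal_J_def
proof safe
  fix i j :: 'n assume "i < j"
  then show "alternant S c e \<in> ideal_gen {Var (Vxi i) - Var (Vxi j), Var (Vyi i) - Var (Vyi j)}"
    using alternant_in_ideal[of "Some i" S "Some j" c e] assms by auto
qed

lemma alternant_in_ideal_I:
  fixes c e :: "'n::{finite,linorder} option \<Rightarrow> nat"
  shows "alternant UNIV c e \<in> ideal_I"
  unfolding ideal_I_def
proof safe
  fix i :: 'n
  show "alternant UNIV c e \<in> ideal_gen {Var (Vxi i) - Var Vx, Var (Vyi i) - Var Vy}"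
    using alternant_in_ideal[of "Some i" UNIV None c e] by auto
qed

text \<open>
  The \<open>x\<close>-exponents and the set of points of the \<open>r\<close>-th of \<open>P\<close> alternating factors. Only the factors
  with \<open>r \<ge> M\<close> involve the extra point: they are the ones whose \<open>x\<close>-exponent at a point leaves
  \<open>0\<close> first when \<open>a\<close> grows, after which the extra point costs no power of \<open>y\<^sub>j\<close>.
\<close>

definition stair :: "nat \<Rightarrow> ('n \<Rightarrow> nat) \<Rightarrow> nat \<Rightarrow> 'n option \<Rightarrow> nat" where
  "stair P a r = case_option 0 (\<lambda>j. (a j + r) div P)"

definition stair_points :: "nat \<Rightarrow> nat \<Rightarrow> 'n option set" where
  "stair_points M r = (if r < M then range Some else UNIV)"

text \<open>
  Counted over all factors, a point \<open>i < j\<close> contributes to the \<open>y\<close>-exponent at \<open>j\<close> once for every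
  factor that gives both points the same \<open>x\<close>-exponent, and the extra point once for every factor that
  involves it and gives the point \<open>j\<close> the \<open>x\<close>-exponent \<open>0\<close>.
\<close>

lemma sum_level_stair_le:
  fixes a :: "'n::{finite,linorder} \<Rightarrow> nat"
  assumes mono: "mono a"
  shows "(\<Sum>r<M + K. level (stair_points M r) (stair (M + K) a r) (Some j))
    \<le> K - a j + (\<Sum>i<j. M + K - (a j - a i))"
proof -
  define P where "P = M + K"
  have level: "level (stair_points M r) (stair P a r) (Some j) =
      of_bool (M \<le> r \<and> (a j + r) div P = 0) + (\<Sum>i<j. of_bool ((a i + r) div P = (a j + r) div P))" for r
  proof -
    have "{q' \<in> stair_points M r. q' < Some j \<and> stair P a r q' = stair P a r (Some j)} =
        (if M \<le> r \<and> (a j + r) div P = 0 then {None} else {}) \<union>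
        Some ` {i. i < j \<and> (a i + r) div P = (a j + r) div P}" (is "?L = ?A \<union> ?B")
    proof (rule set_eqI)
      fix q' show "q' \<in> ?L \<longleftrightarrow> q' \<in> ?A \<union> ?B"
        by (cases q') (auto simp: stair_def stair_points_def)
    qed
    moreover have "card (?A \<union> ?B) = card ?A + card ?B"
      by (rule card_Un_disjoint) auto
    moreover have "card ?B = (\<Sum>i<j. of_bool ((a i + r) div P = (a j + r) div P))"
      by (simp add: card_image lessThan_def Int_def)
    ultimately show ?thesis by (simp add: level_def)
  qed
  have "(\<Sum>r<P. level (stair_points M r) (stair P a r) (Some j)) =
      card {r. r < P \<and> M \<le> r \<and> (a j + r) div P = 0} +
      (\<Sum>i<j. card {r. r < P \<and> (a i + r) div P = (a j + r) div P})"
    unfolding level sum.distrib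
    by (subst sum.swap) (simp add: lessThan_def Int_def)
  also have "\<dots> \<le> (P - M - a j) + (\<Sum>i<j. P - (a j - a i))"
    by (intro add_mono sum_mono card_zero_quotients_le card_equal_quotients_le)
      (use mono in \<open>auto intro: monoD\<close>)
  finally show ?thesis by (simp add: P_def)
qed

lemma of_int_sign_power:
  "of_int (sign \<sigma>) ^ d = (of_int (sgn_char d \<sigma>) :: 'a::ring_1)"
  by (cases \<sigma> rule: sign_cases) (auto simp: sgn_char_def)

definition place :: "'n::linorder \<Rightarrow> nat" where
  "place j = card {..<j}"

lemma place_less: "i < j \<Longrightarrow> place i < place j" for i j :: "'n::{finite,linorder}"
  unfolding place_def by (rule psubset_card_mono) auto

text \<open>
  If \<open>M + K\<close> is positive, the product of the \<open>M + K\<close> alternants with staircase exponents has the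
  exponent \<open>a j\<close> of \<open>x\<^sub>j\<close> and at most the exponent \<open>b j\<close> of \<open>y\<^sub>j\<close>. The missing powers of the \<open>y\<^sub>j\<close> come from
  the product of two further alternants, which is symmetric; in an alternant with strictly increasing
  \<open>x\<close>-exponents the \<open>y\<close>-exponents are arbitrary, at the price of the shift \<open>2 * place j\<close>.
\<close>

lemma exists_section_with_trailing_exp:
  fixes a b :: "'n::{finite,linorder} \<Rightarrow> nat"
  assumes mono: "mono a"
    and b: "\<And>j. K - a j + (\<Sum>i<j. M + K - (a j - a i)) \<le> b j"
  obtains f :: "'n cpoly" where "f \<in> nested_hilb_sections M K" "f \<noteq> 0"
    "Poly_Mapping.lookup (trailing_exp f) Vx = ax" "Poly_Mapping.lookup (trailing_exp f) Vy = ay"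
    "\<And>j. Poly_Mapping.lookup (trailing_exp f) (Vxi j) = a j + 2 * place j"
    "\<And>j. Poly_Mapping.lookup (trailing_exp f) (Vyi j) = b j"
proof -
  define P where "P = M + K"
  define F :: "nat \<Rightarrow> 'n cpoly" where "F r = alternant (stair_points M r) (stair P a r) (level (stair_points M r) (stair P a r))" for r
  define G where "G = (\<Prod>r<P. F r)"
  define \<beta> where "\<beta> j = b j - (\<Sum>r<P. level (stair_points M r) (stair P a r) (Some j))" for j
  \<comment> \<open>For \<open>P = 0\<close> there are no staircase factors, and the \<open>x\<close>-exponents have to come from \<open>A2\<close>.\<close>
  define a' where "a' j = (if P = 0 then a j else 0)" for j
  define A1 :: "'n cpoly" where "A1 = alternant (range Some) (case_option 0 place) (\<lambda>_. 0)"
  define A2 where "A2 = alternant (range Some) (case_option 0 (\<lambda>j. place j + a' j)) (case_option 0 \<beta>)"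
  define f where "f = Var Vx ^ ax * Var Vy ^ ay * (A1 * A2) * G"
  have mono_a: "a i \<le> a j" if "i \<le> j" for i j using mono that by (auto dest: monoD)
  have "stepped (range Some) (case_option 0 (place :: 'n \<Rightarrow> nat)) (\<lambda>_. 0)"
    by (auto simp: stepped_def place_less)
  note A1 = trailing_exp_alternant[OF this, folded A1_def]
  have "stepped (range Some) (case_option 0 (\<lambda>j. place j + a' j)) (case_option 0 \<beta>)"
    using mono_a by (auto simp: stepped_def a'_def intro!: add_less_le_mono place_less)
  note A2 = trailing_exp_alternant[OF this, folded A2_def]
  have "stair P a r q \<le> stair P a r q'" if "q \<le> q'" for r q q'
    using that mono_a by (cases q; cases q') (auto simp: stair_def intro!: div_le_mono)
  then have "stepped (stair_points M r) (stair P a r) (level (stair_points M r) (stair P a r))" for r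
    by (rule stepped_level)
  note F = trailing_exp_alternant[OF this, folded F_def]
  note [simp] = Var_neq_zero
  have [simp]: "G \<noteq> 0" using F(2) by (simp add: G_def)
  have te: "Poly_Mapping.lookup (trailing_exp f) v =
      Poly_Mapping.lookup (Poly_Mapping.single Vx ax) v + Poly_Mapping.lookup (Poly_Mapping.single Vy ay) v +
      (Poly_Mapping.lookup (trailing_exp A1) v + Poly_Mapping.lookup (trailing_exp A2) v) +
      (\<Sum>r<P. Poly_Mapping.lookup (trailing_exp (F r)) v)" for v
  proof -
    have "trailing_exp f = Poly_Mapping.single Vx ax + Poly_Mapping.single Vy ay +
      (trailing_exp A1 + trailing_exp A2) + (\<Sum>r<P. trailing_exp (F r))"
      using A1(2) A2(2) F(2)
      by (simp add: f_def trailing_exp_mult G_def trailing_exp_prod)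
        (simp add: Var_power trailing_exp_single add.assoc)
    then show ?thesis by (simp add: lookup_add lookup_sum)
  qed
  have Some_in: "Some j \<in> stair_points M r" for j :: 'n and r by (auto simp: stair_points_def)
  have None_level: "level S c None = 0" for S and c :: "'n option \<Rightarrow> nat"
    by (simp add: level_def)
  have a_eq: "a' j + (\<Sum>r<P. (a j + r) div P) = a j" for j
    by (cases "P = 0") (simp_all add: a'_def sum_div_shifts)
  have b_eq: "\<beta> j + (\<Sum>r<P. level (stair_points M r) (stair P a r) (Some j)) = b j" for j
    using sum_level_stair_le[OF mono, of M K j] b[of j] by (simp add: \<beta>_def P_def)
  note l = lookup_alternant_exp(1)[where q = "Some j" for j, simplified px.simps]
    lookup_alternant_exp(2)[where q = "Some j" for j, simplified py.simps]
    lookup_alternant_exp(1)[where q = None, simplified px.simps]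
    lookup_alternant_exp(2)[where q = None, simplified py.simps]
  show thesis
  proof (rule that[of f])
    show "f \<noteq> 0" using A1(2) A2(2) by (simp add: f_def)
    show "Poly_Mapping.lookup (trailing_exp f) Vx = ax"
      unfolding te A1(1) A2(1) F(1) l by (simp add: lookup_single stair_def)
    show "Poly_Mapping.lookup (trailing_exp f) Vy = ay"
      unfolding te A1(1) A2(1) F(1) l by (simp add: lookup_single None_level)
    show "Poly_Mapping.lookup (trailing_exp f) (Vxi j) = a j + 2 * place j" for j
      unfolding te A1(1) A2(1) F(1) l using a_eq[of j]
      by (simp add: lookup_single stair_def Some_in)
    show "Poly_Mapping.lookup (trailing_exp f) (Vyi j) = b j" for j
      unfolding te A1(1) A2(1) F(1) l using b_eq[of j]
      by (simp add: lookup_single Some_in)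
    have "G \<in> ideal_pow ideal_J (card {..<P})"
      unfolding G_def F_def
      by (intro prod_in_ideal_pow alternant_in_ideal_J) (auto simp: stair_points_def)
    then have J: "f \<in> ideal_pow ideal_J (M + K)"
      unfolding f_def P_def by (intro ideal_pow_mult) simp
    have "(\<Prod>r\<in>{M..<P}. F r) \<in> ideal_pow ideal_I (card {M..<P})"
      unfolding F_def
      by (intro prod_in_ideal_pow) (auto simp: stair_points_def intro: alternant_in_ideal_I)
    then have "(\<Prod>r<M. F r) * (\<Prod>r\<in>{M..<P}. F r) \<in> ideal_pow ideal_I K"
      unfolding P_def by (intro ideal_pow_mult) simp
    also have "(\<Prod>r<M. F r) * (\<Prod>r\<in>{M..<P}. F r) = G"
      unfolding G_def P_def by (subst prod.union_disjoint[symmetric]) (auto intro!: prod.cong)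
    finally have I: "f \<in> ideal_pow ideal_I K"
      unfolding f_def by (intro ideal_pow_mult)
    have "perm_poly \<sigma> f = of_int (sgn_char (M + K) \<sigma>) * f" if \<sigma>: "\<sigma> permutes UNIV" for \<sigma>
    proof -
      have bij: "bij \<sigma>" using \<sigma> by (rule permutes_bij)
      have "perm_poly \<sigma> G = of_int (sign \<sigma>) ^ P * G"
        using \<sigma> by (simp add: G_def F_def perm_poly_prod bij perm_poly_alternant stair_points_def
          prod.distrib)
      moreover have "perm_poly \<sigma> A1 * perm_poly \<sigma> A2 = A1 * A2"
      proof -
        have "perm_poly \<sigma> A1 * perm_poly \<sigma> A2 = of_int (sign \<sigma>) ^ 2 * (A1 * A2)"
          using \<sigma> by (simp add: A1_def A2_def perm_poly_mult bij perm_poly_alternant power2_eq_square)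
        then show ?thesis by (simp add: of_int_sign_power sgn_char_def)
      qed
      ultimately show ?thesis
        by (simp only: f_def perm_poly_mult[OF bij] perm_poly_power[OF bij] perm_poly_Var[OF bij]
            perm_var.simps of_int_sign_power P_def) (simp only: mult.left_commute)
    qed
    with J I show "f \<in> nested_hilb_sections M K"
      by (simp add: nested_hilb_sections_def)
  qed
qed

section \<open>The Newton-Okounkov body\<close>

lemma positive_part_convex:
  fixes q x y u v :: real
  assumes "0 \<le> u" "0 \<le> v" "u + v = 1"
  shows "max (q - (u * x + v * y)) 0 \<le> u * max (q - x) 0 + v * max (q - y) 0"
proof -
  have "q - (u * x + v * y) = u * (q - x) + v * (q - y)"
  proof -
    have "u * (q - x) + v * (q - y) = (u + v) * q - (u * x + v * y)" by (simp add: algebra_simps)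
    then show ?thesis using assms(3) by simp
  qed
  also have "\<dots> \<le> u * max (q - x) 0 + v * max (q - y) 0"
    using assms by (intro add_mono mult_left_mono) auto
  finally show ?thesis using assms by simp
qed

lemma convex_Delta: "convex (Delta p q :: ((real ^ 'n::{finite,linorder}) \<times> (real ^ 'n::{finite,linorder})) set)"
proof (rule convexI)
  fix s t :: "(real ^ 'n::{finite,linorder}) \<times> (real ^ 'n::{finite,linorder})" and u v :: real
  assume s: "s \<in> Delta p q" and t: "t \<in> Delta p q" and uv: "0 \<le> u" "0 \<le> v" "u + v = 1"
  obtain a b a' b' where st: "s = (a, b)" "t = (a', b')" by (cases s, cases t)
  have S: "0 \<le> a $ i" "i \<le> j \<Longrightarrow> a $ i \<le> a $ j"
    "max (q - a $ j) 0 + (\<Sum>i\<in>{..<j}. max (p - (a $ j - a $ i)) 0) \<le> b $ j" for i j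
    using s by (auto simp: Delta_def st)
  have T: "0 \<le> a' $ i" "i \<le> j \<Longrightarrow> a' $ i \<le> a' $ j"
    "max (q - a' $ j) 0 + (\<Sum>i\<in>{..<j}. max (p - (a' $ j - a' $ i)) 0) \<le> b' $ j" for i j
    using t by (auto simp: Delta_def st)
  have "max (q - (u * a $ j + v * a' $ j)) 0 +
      (\<Sum>i\<in>{..<j}. max (p - ((u * a $ j + v * a' $ j) - (u * a $ i + v * a' $ i))) 0)
    \<le> u * b $ j + v * b' $ j" for j
  proof -
    have "max (p - ((u * a $ j + v * a' $ j) - (u * a $ i + v * a' $ i))) 0 \<le>
        u * max (p - (a $ j - a $ i)) 0 + v * max (p - (a' $ j - a' $ i)) 0" for i
      using positive_part_convex[OF uv, of p "a $ j - a $ i" "a' $ j - a' $ i"] by (simp add: algebra_simps)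
    then have "max (q - (u * a $ j + v * a' $ j)) 0 +
      (\<Sum>i\<in>{..<j}. max (p - ((u * a $ j + v * a' $ j) - (u * a $ i + v * a' $ i))) 0) \<le>
      (u * max (q - a $ j) 0 + v * max (q - a' $ j) 0) +
      (\<Sum>i\<in>{..<j}. u * max (p - (a $ j - a $ i)) 0 + v * max (p - (a' $ j - a' $ i)) 0)"
      by (intro add_mono sum_mono positive_part_convex[OF uv])
    also have "\<dots> = u * (max (q - a $ j) 0 + (\<Sum>i\<in>{..<j}. max (p - (a $ j - a $ i)) 0)) +
        v * (max (q - a' $ j) 0 + (\<Sum>i\<in>{..<j}. max (p - (a' $ j - a' $ i)) 0))"
      by (simp only: sum.distrib sum_distrib_left distrib_left add.assoc add.commute add.left_commute)
    also have "\<dots> \<le> u * b $ j + v * b' $ j"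
      using S(3) T(3) uv by (intro add_mono mult_left_mono) auto
    finally show ?thesis .
  qed
  moreover have "0 \<le> u * a $ i + v * a' $ i" for i
    using S(1)[of i] T(1)[of i] uv by simp
  moreover have "u * a $ i + v * a' $ i \<le> u * a $ j + v * a' $ j" if "i \<le> j" for i j
    using S(2)[OF that] T(2)[OF that] uv by (intro add_mono mult_left_mono) auto
  ultimately show "u *\<^sub>R s + v *\<^sub>R t \<in> Delta p q"
    by (simp add: Delta_def st)
qed

lemma closed_Delta: "closed (Delta p q)"
proof -
  have "Delta p q = {x. (\<forall>i. 0 \<le> fst x $ i) \<and> (\<forall>i j. i \<le> j \<longrightarrow> fst x $ i \<le> fst x $ j) \<and>
      (\<forall>j. max (q - fst x $ j) 0 + (\<Sum>i\<in>{..<j}. max (p - (fst x $ j - fst x $ i)) 0) \<le> snd x $ j)}"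
    by (auto simp: Delta_def)
  also have "closed \<dots>"
    by (intro closed_Collect_conj closed_Collect_all closed_Collect_imp closed_Collect_le
        open_Collect_const continuous_intros)
  finally show ?thesis .
qed

lemma scaled_nu_in_body:
  fixes f :: "'n::{finite,linorder} cpoly"
  assumes d: "1 \<le> d" and f: "f \<in> nested_hilb_sections (d * m) (d * k)" "f \<noteq> 0"
  shows "(1 / real d) *\<^sub>R nu f \<in> {0..} \<times> {0..} \<times> Delta (real (m + k)) (real k)"
proof -
  define a where "a i = Poly_Mapping.lookup (trailing_exp f) (Vxi i)" for i
  define b where "b i = Poly_Mapping.lookup (trailing_exp f) (Vyi i)" for i
  have mono: "a i \<le> a j" if "i \<le> j" for i j
    unfolding a_def using f that
    by (intro trailing_exp_mono[where d = "d * m + d * k"]) (auto simp: nested_hilb_sections_def)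
  have scale: "max (real q - real x / real d) 0 = real (d * q - x) / real d" for q x :: nat
  proof -
    have "real (d * q - x) = max (real d * real q - real x) 0"
    proof (cases "x \<le> d * q")
      case True
      then have "real x \<le> real (d * q)" by (simp only: of_nat_le_iff)
      then show ?thesis using of_nat_diff[OF True, where ?'a = real] by simp
    next
      case False
      then have "real (d * q) \<le> real x" by (simp only: of_nat_le_iff)
      with False show ?thesis by simp
    qed
    then show ?thesis using d by (simp add: max_divide_distrib_right diff_divide_distrib)
  qed
  have "max (real k - real (a j) / real d) 0 +
      (\<Sum>i\<in>{..<j}. max (real (m + k) - (real (a j) / real d - real (a i) / real d)) 0) \<le> real (b j) / real d" for j
  proof -
    have diff: "real (a j) / real d - real (a i) / real d = real (a j - a i) / real d" if "i < j" for i
      using mono[of i j] that by (simp add: diff_divide_distrib)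
    have "max (real k - real (a j) / real d) 0 +
      (\<Sum>i\<in>{..<j}. max (real (m + k) - (real (a j) / real d - real (a i) / real d)) 0) =
      real (d * k - a j) / real d + (\<Sum>i\<in>{..<j}. real (d * (m + k) - (a j - a i)) / real d)"
      unfolding scale[symmetric]
      by (intro arg_cong2[where f = "(+)"] sum.cong refl) (simp only: diff lessThan_iff)
    also have "\<dots> = real (d * k - a j + (\<Sum>i<j. d * m + d * k - (a j - a i))) / real d"
      by (simp only: of_nat_add of_nat_sum add_divide_distrib sum_divide_distrib distrib_left)
    also have "\<dots> \<le> real (b j) / real d"
      using trailing_exp_section_bound[OF f refl, of j]
      by (intro divide_right_mono) (simp_all only: a_def b_def of_nat_le_iff of_nat_0_le_iff)
    finally show ?thesis .
  qed
  moreover have "real (a i) / real d \<le> real (a j) / real d" if "i \<le> j" for i j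
    using mono[OF that] by (simp add: divide_right_mono)
  ultimately show ?thesis
    by (simp add: nu_def Let_def Delta_def flip: a_def b_def)
qed

lemma scaled_limit:
  fixes g :: "nat \<Rightarrow> real"
  assumes "\<And>N. \<bar>g N - real (Suc N) * A\<bar> \<le> C"
  shows "(\<lambda>N. g N / real (Suc N)) \<longlonglongrightarrow> A"
proof (rule LIM_zero_cancel, rule Lim_null_comparison)
  show "\<forall>\<^sub>F N in sequentially. norm (g N / real (Suc N) - A) \<le> C * inverse (real (Suc N))"
  proof (intro always_eventually allI)
    fix N
    have "g N / real (Suc N) - A = (g N - real (Suc N) * A) / real (Suc N)"
      by (simp add: field_simps)
    then have "norm (g N / real (Suc N) - A) = \<bar>g N - real (Suc N) * A\<bar> / real (Suc N)"
      by simp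
    also have "\<dots> \<le> C / real (Suc N)" using assms by (intro divide_right_mono) auto
    finally show "norm (g N / real (Suc N) - A) \<le> C * inverse (real (Suc N))"
      by (simp add: divide_inverse)
  qed
  show "(\<lambda>N. C * inverse (real (Suc N))) \<longlonglongrightarrow> 0"
    using tendsto_mult_right_zero[OF LIMSEQ_inverse_real_of_nat] .
qed

lemma floor_bound: "0 \<le> x \<Longrightarrow> \<bar>real (nat \<lfloor>x\<rfloor>) - x\<bar> \<le> 1"
  by linarith

text \<open>
  Rounding \<open>d A\<close> down changes each of the at most \<open>n\<close> summands in the lower bound for the \<open>j\<close>-th
  \<open>y\<close>-exponent by at most \<open>1\<close>; adding \<open>n\<close> to \<open>d B\<close> compensates for this, and the error disappears
  after division by \<open>d\<close>.
\<close>

lemma body_approximation: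
  fixes A B :: "real ^ 'n::{finite,linorder}"
  assumes AB: "(A, B) \<in> Delta (real (m + k)) (real k)" and nn: "0 \<le> A0" "0 \<le> B0"
  shows "(A0, B0, A, B) \<in> newton_okounkov_body
    (\<lambda>d. nested_hilb_sections (d * m) (d * k) :: 'n cpoly set)"
proof -
  define U where "U = (\<Union>d\<in>{1..}. (\<lambda>f. (1 / real d) *\<^sub>R nu f) `
    (nested_hilb_sections (d * m) (d * k) - {0 :: 'n cpoly}))"
  have A_nn: "0 \<le> A $ i" and A_mono: "i \<le> j \<Longrightarrow> A $ i \<le> A $ j"
    and B: "max (real k - A $ j) 0 + (\<Sum>i\<in>{..<j}. max (real (m + k) - (A $ j - A $ i)) 0) \<le> B $ j" for i j
    using AB by (auto simp: Delta_def)
  have B_nn: "0 \<le> B $ j" for j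
    by (rule order_trans[OF _ B[of j]]) (auto intro!: add_nonneg_nonneg sum_nonneg)
  define a where "a N j = nat \<lfloor>real (Suc N) * A $ j\<rfloor>" for N j
  define b where "b N j = nat \<lceil>real (Suc N) * B $ j\<rceil> + CARD('n)" for N j
  define a0 where "a0 N = nat \<lfloor>real (Suc N) * A0\<rfloor>" for N
  define b0 where "b0 N = nat \<lfloor>real (Suc N) * B0\<rfloor>" for N
  define s :: "nat \<Rightarrow> real \<times> real \<times> (real ^ 'n::{finite,linorder}) \<times> (real ^ 'n::{finite,linorder})" where "s N = (real (a0 N) / real (Suc N), real (b0 N) / real (Suc N),
    (\<chi> j. real (a N j + 2 * place j) / real (Suc N)), (\<chi> j. real (b N j) / real (Suc N)))" for N
  have a: "\<bar>real (a N j) - real (Suc N) * A $ j\<bar> \<le> 1"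
    and a_upper: "real (a N j) \<le> real (Suc N) * A $ j" for N j
    using A_nn[of j] by (simp_all only: a_def floor_bound zero_le_mult_iff of_nat_0_le_iff simp_thms)
      (simp_all add: a_def)
  have "s N \<in> U" for N
  proof -
    define d where "d = Suc N"
    have "mono (a N)"
      unfolding a_def by (intro monoI nat_mono floor_mono mult_left_mono A_mono) auto
    moreover have "d * k - a N j + (\<Sum>i<j. d * m + d * k - (a N j - a N i)) \<le> b N j" for j
    proof -
      have 1: "real (d * k - a N j) \<le> real d * max (real k - A $ j) 0 + 1"
      proof -
        have "real d * (real k - A $ j) \<le> real d * max (real k - A $ j) 0" "0 \<le> real d * max (real k - A $ j) 0"
          by (auto intro: mult_left_mono)
        moreover have "real d * (real k - A $ j) = real (d * k) - real d * A $ j"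
          by (simp add: right_diff_distrib)
        ultimately show ?thesis using a[of N j] unfolding d_def[symmetric] by linarith
      qed
      have 2: "real (d * m + d * k - (a N j - a N i)) \<le> real d * max (real (m + k) - (A $ j - A $ i)) 0 + 1" for i
      proof -
        have "real d * (real (m + k) - (A $ j - A $ i)) \<le> real d * max (real (m + k) - (A $ j - A $ i)) 0"
          "0 \<le> real d * max (real (m + k) - (A $ j - A $ i)) 0"
          by (auto intro: mult_left_mono)
        moreover have "real d * (real (m + k) - (A $ j - A $ i)) =
            real (d * m + d * k) - real d * A $ j + real d * A $ i"
          by (simp add: algebra_simps)
        ultimately show ?thesis using a[of N j] a_upper[of N i] unfolding d_def[symmetric] by linarith
      qed
      have "real (d * k - a N j + (\<Sum>i<j. d * m + d * k - (a N j - a N i))) \<le>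
          (real d * max (real k - A $ j) 0 + 1) + (\<Sum>i<j. real d * max (real (m + k) - (A $ j - A $ i)) 0 + 1)"
        unfolding of_nat_add of_nat_sum by (intro add_mono sum_mono 1 2[unfolded of_nat_add])
      also have "\<dots> = real d * (max (real k - A $ j) 0 + (\<Sum>i<j. max (real (m + k) - (A $ j - A $ i)) 0)) +
          (1 + real (card {..<j}))"
        by (simp add: sum.distrib distrib_left sum_distrib_left)
      also have "\<dots> \<le> real d * B $ j + real (CARD('n))"
      proof (rule add_mono)
        show "real d * (max (real k - A $ j) 0 + (\<Sum>i<j. max (real (m + k) - (A $ j - A $ i)) 0)) \<le> real d * B $ j"
          using B by (intro mult_left_mono) auto
        have "card {..<j} < CARD('n)" by (intro psubset_card_mono) auto
        then show "1 + real (card {..<j}) \<le> real (CARD('n))" by linarith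
      qed
      also have "\<dots> \<le> real (b N j)"
        unfolding b_def d_def of_nat_add by (intro add_mono real_nat_ceiling_ge) simp
      finally show ?thesis by (simp only: of_nat_le_iff)
    qed
    ultimately obtain f :: "'n cpoly" where f: "f \<in> nested_hilb_sections (d * m) (d * k)" "f \<noteq> 0"
      "Poly_Mapping.lookup (trailing_exp f) Vx = a0 N" "Poly_Mapping.lookup (trailing_exp f) Vy = b0 N"
      "\<And>j. Poly_Mapping.lookup (trailing_exp f) (Vxi j) = a N j + 2 * place j"
      "\<And>j. Poly_Mapping.lookup (trailing_exp f) (Vyi j) = b N j"
      by (rule exists_section_with_trailing_exp[where ax = "a0 N" and ay = "b0 N"]) blast
    have "s N = (1 / real d) *\<^sub>R nu f"
      by (simp add: s_def nu_def Let_def f(3-6) d_def vec_eq_iff)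
    moreover have "d \<in> {1..}" by (simp add: d_def)
    ultimately show ?thesis using f(1,2) unfolding U_def by blast
  qed
  moreover have "s \<longlonglongrightarrow> (A0, B0, A, B)"
    unfolding s_def
  proof (intro tendsto_Pair vec_tendstoI)
    show "(\<lambda>N. real (a0 N) / real (Suc N)) \<longlonglongrightarrow> A0"
      by (rule scaled_limit[where C = 1]) (simp only: a0_def, rule floor_bound, simp add: nn)
    show "(\<lambda>N. real (b0 N) / real (Suc N)) \<longlonglongrightarrow> B0"
      by (rule scaled_limit[where C = 1]) (simp only: b0_def, rule floor_bound, simp add: nn)
    fix j
    have "\<bar>real (a N j + 2 * place j) - real (Suc N) * A $ j\<bar> \<le> 1 + 2 * real (place j)" for N
      using a[of N j] by simp
    then show "(\<lambda>N. (\<chi> j. real (a N j + 2 * place j) / real (Suc N)) $ j) \<longlonglongrightarrow> A $ j"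
      unfolding vec_lambda_beta by (rule scaled_limit)
    have "\<bar>real (b N j) - real (Suc N) * B $ j\<bar> \<le> 1 + real (CARD('n))" for N
    proof -
      have "0 \<le> real (Suc N) * B $ j" using B_nn by simp
      then show ?thesis unfolding b_def of_nat_add by linarith
    qed
    then show "(\<lambda>N. (\<chi> j. real (b N j) / real (Suc N)) $ j) \<longlonglongrightarrow> B $ j"
      unfolding vec_lambda_beta by (rule scaled_limit)
  qed
  ultimately have "(A0, B0, A, B) \<in> closure U"
    unfolding closure_sequential by blast
  then show ?thesis
    unfolding newton_okounkov_body_def U_def[symmetric]
    using closure_mono[OF hull_subset] by blast
qed

theorem theorem1p6:
  fixes m k :: nat
  shows "newton_okounkov_body
      (\<lambda>d. nested_hilb_sections (d * m) (d * k) :: 'n::{finite,linorder} cpoly set)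
    = {0..} \<times> {0..} \<times> Delta (real (m + k)) (real k)"
proof
  show "newton_okounkov_body (\<lambda>d. nested_hilb_sections (d * m) (d * k) :: 'n cpoly set)
    \<subseteq> {0..} \<times> {0..} \<times> Delta (real (m + k)) (real k)"
    unfolding newton_okounkov_body_def
  proof (intro closure_minimal hull_minimal)
    show "(\<Union>d\<in>{1..}. (\<lambda>f. (1 / real d) *\<^sub>R nu f) ` (nested_hilb_sections (d * m) (d * k) - {0 :: 'n cpoly}))
      \<subseteq> {0..} \<times> {0..} \<times> Delta (real (m + k)) (real k)"
      using scaled_nu_in_body by blast
    show "convex ({0::real..} \<times> {0::real..} \<times> Delta (real (m + k)) (real k))"
      by (intro convex_Times convex_Delta convex_real_interval)
    show "closed ({0::real..} \<times> {0::real..} \<times> Delta (real (m + k)) (real k))"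
      by (intro closed_Times closed_Delta closed_atLeast)
  qed
  show "{0..} \<times> {0..} \<times> Delta (real (m + k)) (real k)
    \<subseteq> newton_okounkov_body (\<lambda>d. nested_hilb_sections (d * m) (d * k) :: 'n cpoly set)"
    using body_approximation by auto
qed

end
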